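(* Let $n\ge 3$. The multivariate avalanche polynomial of the wheel graph $W_n$ (with the dominating vertex as sink) is $$\mathscr{A}_{W_n}(x_0,\dots,x_{n-1}) = n^2\,w_n(x_0,\dots,x_{n-1})+\sum_{m=1}^{n-1} m\, f_{2(n-m)}\,w_m(x_0,\dots,x_{n-1})+2n\,(f_{2n-1}-1),$$ where $f_k$ is the $k$-th Fibonacci number ($f_0=0$, $f_1=1$, $f_k=f_{k-1}+f_{k-2}$), $w_m(x_0,\dots,x_{n-1})=\sum_{i=0}^{n-1}x_ix_{i+1}\cdots x_{i+m-1}$ for $1\le m\le n-1$ (indices modulo $n$), and $w_n(x_0,\dots,x_{n-1})=x_0x_1\cdots x_{n-1}$.
   Context: A graph $G=(V,E,s)$ is a finite connected undirected multigraph without loops, with a distinguished vertex $s$ called the sink; $\widetilde V = V\setminus\{s\}$. $d_v$ is the degree of $v$ (counted with multiplicity, including edges to $s$) and $\mathrm{wt}(u,v)$ is the number of edges between $u$ and $v$. A sandpile is a function $c:\widetilde V\to\mathbb{Z}_{\ge 0}$. A vertex $v\in\widetilde V$ is unstable if $c(v)\ge d_v$; an unstable vertex may topple, which replaces $c$ by $c'$ with $c'(v)=c(v)-d_v$ and $c'(w)=c(w)+\mathrm{wt}(v,w)$ for $w\in\widetilde V$, $w\ne v$. A sandpile is stable if it has no unstable vertex. Any sequence of topplings of unstable vertices starting at $c$ that ends in a stable sandpile ends in the same stable sandpile $c^\circ$ (the stabilization), with the same number of topplings of each vertex; the vector of these numbers is the toppling vector of the stabilization. Put $a\oplus b=(a+b)^\circ$.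 A stable sandpile $c$ is recurrent if for every sandpile $a$ there is a sandpile $b$ with $a\oplus b=c$; the set of recurrent sandpiles is $\mathscr{S}(G)$. For $v\in\widetilde V$, $1_v$ is the sandpile with one grain at $v$ and none elsewhere. Each non-sink vertex $v_i$ has an associated variable $x_i$. For $c$ recurrent, the avalanche monomial is $\mu_G(c,v_k)=\prod_{i} x_i^{f_i}$, where here $f_i$ is the entry at $v_i$ of the toppling vector of the stabilization of $c+1_{v_k}$ (not a Fibonacci number). The multivariate avalanche polynomial is $\mathscr{A}_G=\sum_{c\in\mathscr{S}(G)}\sum_{v\in\widetilde V}\mu_G(c,v)$. The wheel graph $W_n$ ($n\ge3$) is the cycle on $n$ vertices $v_0,\dots,v_{n-1}$ in cyclic order (indices modulo $n$) together with an additional vertex $s$ joined by one edge to each $v_i$; $s$ is the sink. *)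

theory Defs
  imports "HOL-Library.Poly_Mapping" "HOL-Number_Theory.Fib"
begin

(* Finite undirected multigraphs with a sink; wt u v is the number of edges between u and v. *)
record 'v sink_graph =
  verts :: "'v set"
  wt :: "'v \<Rightarrow> 'v \<Rightarrow> nat"
  sink :: 'v

locale sandpile_graph =
  fixes G :: "'v sink_graph"
  assumes finite_verts: "finite (verts G)"
    and sink_in_verts: "sink G \<in> verts G"
    and wt_sym: "wt G u v = wt G v u"
    and no_loops: "wt G v v = 0"
    and wt_outside: "u \<notin> verts G \<Longrightarrow> wt G u v = 0"
    and connected: "u \<in> verts G \<Longrightarrow> v \<in> verts G \<Longrightarrow> (u, v) \<in> {(a, b). wt G a b > 0}\<^sup>*"

definition nonsink :: "'v sink_graph \<Rightarrow> 'v set" where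
  "nonsink G = verts G - {sink G}"

definition deg :: "'v sink_graph \<Rightarrow> 'v \<Rightarrow> nat" where
  "deg G v = (\<Sum>u\<in>verts G. wt G v u)"

(* A function on the non-sink vertices is represented by its extension by 0 to the whole type,
   so that equality of sandpiles is equality of functions. *)
definition sandpile :: "'v sink_graph \<Rightarrow> ('v \<Rightarrow> nat) \<Rightarrow> bool" where
  "sandpile G c \<longleftrightarrow> (\<forall>v. v \<notin> nonsink G \<longrightarrow> c v = 0)"

definition unstable :: "'v sink_graph \<Rightarrow> ('v \<Rightarrow> nat) \<Rightarrow> 'v \<Rightarrow> bool" where
  "unstable G c v \<longleftrightarrow> v \<in> nonsink G \<and> c v \<ge> deg G v"

definition stable :: "'v sink_graph \<Rightarrow> ('v \<Rightarrow> nat) \<Rightarrow> bool" where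
  "stable G c \<longleftrightarrow> (\<forall>v. \<not> unstable G c v)"

(* Only applied to unstable v, so the subtraction on nat is not truncated. *)
definition topple :: "'v sink_graph \<Rightarrow> 'v \<Rightarrow> ('v \<Rightarrow> nat) \<Rightarrow> 'v \<Rightarrow> nat" where
  "topple G v c =
     (\<lambda>w. if w = v then c v - deg G v
          else if w \<in> nonsink G then c w + wt G v w else 0)"

(* toppling_seq G c vs c': toppling the vertices of vs in order, each unstable
   when its turn comes, leads from c to c'. *)
inductive toppling_seq ::
  "'v sink_graph \<Rightarrow> ('v \<Rightarrow> nat) \<Rightarrow> 'v list \<Rightarrow> ('v \<Rightarrow> nat) \<Rightarrow> bool" for G where
  Nil: "toppling_seq G c [] c"
| Cons: "unstable G c v \<Longrightarrow> toppling_seq G (topple G v c) vs c'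
          \<Longrightarrow> toppling_seq G c (v # vs) c'"

(* On a sandpile graph the descriptions in the next two definitions are met by exactly one object:
   every sandpile stabilizes, and the result and the toppling numbers do not depend on the order. *)
definition stabilization :: "'v sink_graph \<Rightarrow> ('v \<Rightarrow> nat) \<Rightarrow> ('v \<Rightarrow> nat)" where
  "stabilization G c = (THE c'. \<exists>vs. toppling_seq G c vs c' \<and> stable G c')"

definition toppling_vector :: "'v sink_graph \<Rightarrow> ('v \<Rightarrow> nat) \<Rightarrow> ('v \<Rightarrow> nat)" where
  "toppling_vector G c =
     (THE f. \<exists>vs c'. toppling_seq G c vs c' \<and> stable G c' \<and> f = count_list vs)"

definition sandpile_sum :: "'v sink_graph \<Rightarrow> ('v \<Rightarrow> nat) \<Rightarrow> ('v \<Rightarrow> nat) \<Rightarrow> ('v \<Rightarrow> nat)" where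
  "sandpile_sum G a b = stabilization G (\<lambda>v. a v + b v)"

definition recurrent :: "'v sink_graph \<Rightarrow> ('v \<Rightarrow> nat) \<Rightarrow> bool" where
  "recurrent G c \<longleftrightarrow> sandpile G c \<and> stable G c \<and>
     (\<forall>a. sandpile G a \<longrightarrow> (\<exists>b. sandpile G b \<and> sandpile_sum G a b = c))"

definition add_grain :: "('v \<Rightarrow> nat) \<Rightarrow> 'v \<Rightarrow> ('v \<Rightarrow> nat)" where
  "add_grain c v = (\<lambda>w. c w + (if w = v then 1 else 0))"

(* Integer polynomials in variables indexed by 'v: finitely supported maps from
   exponent vectors to coefficients, with convolution as multiplication. *)
type_synonym 'v int_mpoly = "('v \<Rightarrow>\<^sub>0 nat) \<Rightarrow>\<^sub>0 int"

definition var :: "'v \<Rightarrow> 'v int_mpoly" where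
  "var v = Poly_Mapping.single (Poly_Mapping.single v 1) 1"

definition avalanche_monomial :: "'v sink_graph \<Rightarrow> ('v \<Rightarrow> nat) \<Rightarrow> 'v \<Rightarrow> 'v int_mpoly" where
  "avalanche_monomial G c v =
     (\<Prod>u\<in>nonsink G. var u ^ toppling_vector G (add_grain c v) u)"

definition avalanche_poly :: "'v sink_graph \<Rightarrow> 'v int_mpoly" where
  "avalanche_poly G =
     (\<Sum>c\<in>{c. recurrent G c}. \<Sum>v\<in>nonsink G. avalanche_monomial G c v)"

datatype wheel_vertex = Hub | Rim nat

fun wheel_wt :: "nat \<Rightarrow> wheel_vertex \<Rightarrow> wheel_vertex \<Rightarrow> nat" where
  "wheel_wt n Hub Hub = 0"
| "wheel_wt n Hub (Rim j) = (if j < n then 1 else 0)"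
| "wheel_wt n (Rim i) Hub = (if i < n then 1 else 0)"
| "wheel_wt n (Rim i) (Rim j) =
     (if i < n \<and> j < n \<and> (j = (i + 1) mod n \<or> i = (j + 1) mod n) then 1 else 0)"

definition wheel :: "nat \<Rightarrow> wheel_vertex sink_graph" where
  "wheel n = \<lparr>verts = insert Hub (Rim ` {..<n}), wt = wheel_wt n, sink = Hub\<rparr>"

lemma sandpile_graph_wheel:
  assumes "n \<ge> 3"
  shows "sandpile_graph (wheel n)"
proof
  let ?E = "{(a, b). wt (wheel n) a b > 0}"
  show "finite (verts (wheel n))" "sink (wheel n) \<in> verts (wheel n)"
    by (auto simp: wheel_def)
  show "wt (wheel n) u v = wt (wheel n) v u" for u v
    by (cases u; cases v) (auto simp: wheel_def)
  show "wt (wheel n) v v = 0" for v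
    using assms by (cases v) (auto simp: wheel_def mod_Suc split: if_splits)
  show "wt (wheel n) u v = 0" if "u \<notin> verts (wheel n)" for u v
    using that by (cases u; cases v) (auto simp: wheel_def)
  show "(u, v) \<in> ?E\<^sup>*" if "u \<in> verts (wheel n)" "v \<in> verts (wheel n)" for u v
  proof -
    have "(u, Hub) \<in> ?E\<^sup>*"
      using that(1) by (cases u) (auto simp: wheel_def intro!: r_into_rtrancl)
    moreover have "(Hub, v) \<in> ?E\<^sup>*"
      using that(2) by (cases v) (auto simp: wheel_def intro!: r_into_rtrancl)
    ultimately show ?thesis by (rule rtrancl_trans)
  qed
qed

definition wheel_w :: "nat \<Rightarrow> nat \<Rightarrow> wheel_vertex int_mpoly" where
  "wheel_w n m =
     (if m = n then \<Prod>i<n. var (Rim i)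
      else \<Sum>i<n. \<Prod>k<m. var (Rim ((i + k) mod n)))"

end

theory Submission
  imports Defs
begin

text \<open>
  A stable sandpile on a graph whose sink is adjacent to every vertex is recurrent iff it has no
  forbidden set (Dhar's burning criterion). On the wheel this says that, cyclically, between any
  two zeros (or from a single zero back to itself) there is a \<open>2\<close>, and that some vertex carries a
  \<open>2\<close>; a two-state automaton recognises such cyclic words. A grain dropped on a vertex with fewer
  than two grains causes no toppling. Dropped inside a maximal run of twos it makes every vertex of
  the run topple once; a run of length \<open>n - 1\<close> whose missing letter is \<open>1\<close> also drags the remaining
  vertex along. Reading the word from the vertex that receives the grain, it is a block
  \<open>2\<^sup>a u 2\<^sup>b\<close>, and the automaton shows that there are \<open>f\<^bsub>2(n - a - b)\<^esub>\<close> choices of \<open>u\<close>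
  (besides \<open>u = 1\<close>, which makes every vertex topple).
\<close>

section \<open>Stabilization and recurrence\<close>

text \<open>Even-indexed Fibonacci numbers come from the transfer matrix of the automaton: from
  \<open>True\<close> two letters lead to \<open>True\<close> and one to \<open>False\<close>, from
  \<open>False\<close> one letter leads to each. The matrix with rows (2, 1) and (1, 1) is the
  square of the Fibonacci matrix with rows (1, 1) and (1, 0). The other coefficients record where
  the grain lands. A run of \<open>m\<close> twos can be hit at each of its \<open>m\<close>
  positions. For a fixed drop vertex the full product arises \<open>n\<close> times: from the
  all-two pile and from the \<open>n - 1\<close> piles of twos with a single 1 elsewhere; the
  \<open>n\<close> drop vertices give the square. The constant term collects the drops on a letter
  other than 2. Stabilization and toppling vector are definite descriptions over all legal
  sequences. Two facts tame them: by the least action principle one legal stabilizing sequence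
  determines both, and the avalanches met here topple no vertex twice, so each is described by the
  set of its vertices.\<close>

lemma toppling_seq_append:
  "toppling_seq G c xs d \<Longrightarrow> toppling_seq G d ys e \<Longrightarrow> toppling_seq G c (xs @ ys) e"
  by (induction rule: toppling_seq.induct) (auto intro: toppling_seq.intros)

lemma toppling_seq_snocD:
  "toppling_seq G c (xs @ [v]) e \<Longrightarrow>
    \<exists>d. toppling_seq G c xs d \<and> unstable G d v \<and> e = topple G v d"
proof (induction xs arbitrary: c)
  case Nil
  then show ?case
    by (auto elim!: toppling_seq.cases intro: toppling_seq.intros)
next
  case (Cons x xs)
  from Cons.prems have "unstable G c x" "toppling_seq G (topple G x c) (xs @ [v]) e"
    by (auto elim: toppling_seq.cases)
  with Cons.IH[of "topple G x c"] show ?case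
    by (auto intro: toppling_seq.intros)
qed

lemma toppling_seq_sandpile:
  "toppling_seq G c vs c' \<Longrightarrow> sandpile G c \<Longrightarrow> sandpile G c'"
  by (induction rule: toppling_seq.induct) (auto simp: sandpile_def topple_def unstable_def)

lemma toppling_seq_add:
  "toppling_seq G c vs c' \<Longrightarrow> sandpile G e \<Longrightarrow>
    toppling_seq G (\<lambda>v. c v + e v) vs (\<lambda>v. c' v + e v)"
proof (induction rule: toppling_seq.induct)
  case (Nil c)
  show ?case by (rule toppling_seq.Nil)
next
  case (Cons c v vs c')
  have "topple G v (\<lambda>v. c v + e v) = (\<lambda>w. topple G v c w + e w)"
    using Cons.hyps(1) Cons.prems by (auto simp: topple_def unstable_def sandpile_def)
  with Cons show ?case
    by (auto intro!: toppling_seq.Cons simp: unstable_def)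
qed

lemma count_list_distinct: "distinct xs \<Longrightarrow> count_list xs x = (if x \<in> set xs then 1 else 0)"
  by (induction xs) auto

section \<open>Uniqueness of stabilizations\<close>

context sandpile_graph
begin

lemma finite_nonsink: "finite (nonsink G)"
  using finite_verts by (simp add: nonsink_def)

text \<open>Conservation of grains at one vertex, with the losses moved to the left so that no
  subtraction of naturals occurs.\<close>

lemma toppling_seq_balance:
  assumes "toppling_seq G c vs c'" "w \<in> nonsink G"
  shows "c' w + count_list vs w * deg G w = c w + (\<Sum>u\<in>nonsink G. count_list vs u * wt G u w)"
  using assms
proof (induction rule: toppling_seq.induct)
  case (Cons c v vs c')
  have v: "v \<in> nonsink G" "deg G v \<le> c v" using Cons.hyps(1) by (auto simp: unstable_def)
  have "(\<Sum>u\<in>nonsink G. count_list (v # vs) u * wt G u w)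
      = (\<Sum>u\<in>nonsink G. count_list vs u * wt G u w + (if u = v then wt G v w else 0))"
    by (intro sum.cong) auto
  also have "\<dots> = (\<Sum>u\<in>nonsink G. count_list vs u * wt G u w) + wt G v w"
    using v finite_nonsink by (simp add: sum.distrib)
  finally show ?case
    using Cons.IH[OF Cons.prems] Cons.prems v no_loops by (auto simp: topple_def)
qed simp

text \<open>Least action principle. Suppose the last vertex \<open>v\<close> of a legal sequence had
  already toppled as often as in the stabilizing one. Before that step its neighbours had sent it no
  more grains than they do in the stabilizing sequence, so it would hold at most
  \<open>c' v < deg G v\<close> grains and could not topple.\<close>

lemma count_list_legal_le_stabilizing:
  assumes vs: "toppling_seq G c vs c'" "stable G c'"
    and us: "toppling_seq G c us d"
  shows "count_list us w \<le> count_list vs w"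
  using us
proof (induction us arbitrary: d w rule: rev_induct)
  case (snoc v us)
  obtain e where e: "toppling_seq G c us e" "unstable G e v"
    using toppling_seq_snocD[OF snoc.prems] by auto
  note IH = snoc.IH[OF e(1)]
  have v: "v \<in> nonsink G" "deg G v \<le> e v" using e(2) by (auto simp: unstable_def)
  have c': "c' v < deg G v" using vs(2) v(1) by (auto simp: stable_def unstable_def)
  have "count_list us v \<noteq> count_list vs v"
  proof
    assume eq: "count_list us v = count_list vs v"
    have "(\<Sum>u\<in>nonsink G. count_list us u * wt G u v)
        \<le> (\<Sum>u\<in>nonsink G. count_list vs u * wt G u v)"
      by (intro sum_mono mult_right_mono IH) auto
    moreover have "count_list us v * deg G v = count_list vs v * deg G v"
      using eq by simp
    ultimately show False using toppling_seq_balance[OF e(1) v(1)] toppling_seq_balance[OF vs(1) v(1)] v(2) c'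
      by linarith
  qed
  with IH[of v] IH[of w] show ?case by auto
qed simp

lemma count_list_stabilizing_unique:
  assumes "toppling_seq G c vs c'" "stable G c'" "toppling_seq G c us d" "stable G d"
  shows "count_list us = count_list vs"
proof
  fix w
  show "count_list us w = count_list vs w"
    using count_list_legal_le_stabilizing[OF assms(1-3), of w]
      count_list_legal_le_stabilizing[OF assms(3,4,1), of w] by (rule antisym)
qed

lemma stabilizing_unique:
  assumes "sandpile G c" "toppling_seq G c vs c'" "stable G c'" "toppling_seq G c us d" "stable G d"
  shows "d = c'"
proof
  fix w
  show "d w = c' w"
  proof (cases "w \<in> nonsink G")
    case True
    show ?thesis
      using toppling_seq_balance[OF assms(2) True] toppling_seq_balance[OF assms(4) True]
        count_list_stabilizing_unique[OF assms(2-5)] by simp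
  next
    case False
    then show ?thesis
      using toppling_seq_sandpile[OF assms(2,1)] toppling_seq_sandpile[OF assms(4,1)]
      by (simp add: sandpile_def)
  qed
qed

lemma stabilization_eq:
  assumes "sandpile G c" "toppling_seq G c vs c'" "stable G c'"
  shows "stabilization G c = c'"
  unfolding stabilization_def
proof (rule the_equality)
  show "\<exists>vs. toppling_seq G c vs c' \<and> stable G c'" using assms(2,3) by blast
  show "d = c'" if "\<exists>us. toppling_seq G c us d \<and> stable G d" for d
    using that stabilizing_unique[OF assms] by (elim exE conjE)
qed

lemma toppling_vector_eq:
  assumes "toppling_seq G c vs c'" "stable G c'"
  shows "toppling_vector G c = count_list vs"
  unfolding toppling_vector_def
proof (rule the_equality)
  show "\<exists>us d. toppling_seq G c us d \<and> stable G d \<and> count_list vs = count_list us"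
    using assms by (intro exI[of _ vs] exI[of _ c']) simp
  show "f = count_list vs"
    if "\<exists>us d. toppling_seq G c us d \<and> stable G d \<and> f = count_list us" for f
    using that count_list_stabilizing_unique[OF assms] by (elim exE conjE) simp
qed

end

section \<open>Avalanches that topple each vertex at most once\<close>

definition fired :: "'v sink_graph \<Rightarrow> ('v \<Rightarrow> nat) \<Rightarrow> 'v set \<Rightarrow> 'v \<Rightarrow> nat" where
  "fired G c S = (\<lambda>w. if w \<in> nonsink G
     then c w + (\<Sum>u\<in>S. wt G u w) - (if w \<in> S then deg G w else 0) else 0)"

text \<open>Only the existence of a legal order is kept: the pile reached depends on
  \<open>S\<close> alone, so growing an avalanche amounts to inserting vertices into a set.\<close>

definition fires :: "'v sink_graph \<Rightarrow> ('v \<Rightarrow> nat) \<Rightarrow> 'v set \<Rightarrow> bool" where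
  "fires G c S \<longleftrightarrow> (\<exists>vs. distinct vs \<and> set vs = S \<and> toppling_seq G c vs (fired G c S))"

lemma fires_empty:
  assumes "sandpile G c"
  shows "fires G c {}"
proof -
  have "fired G c {} = c" using assms by (auto simp: fired_def sandpile_def)
  then show ?thesis
    unfolding fires_def by (intro exI[of _ "[]"]) (simp add: toppling_seq.Nil)
qed

context sandpile_graph
begin

lemma fires_insert:
  assumes S: "fires G c S" "v \<notin> S" and v: "v \<in> nonsink G"
    and le: "deg G v \<le> c v + (\<Sum>u\<in>S. wt G u v)"
  shows "fires G c (insert v S)"
proof -
  obtain vs where vs: "distinct vs" "set vs = S" "toppling_seq G c vs (fired G c S)"
    using S(1) by (auto simp: fires_def)
  have fin: "finite S" using vs(2) by auto
  have un: "unstable G (fired G c S) v"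
    using v le S(2) by (auto simp: unstable_def fired_def)
  have "topple G v (fired G c S) = fired G c (insert v S)"
  proof
    fix w
    \<comment> \<open>Guards the truncated subtraction in \<open>fired G c S\<close>: by
      conservation, a vertex that has toppled once held or received at least its degree.\<close>
    have "deg G w \<le> c w + (\<Sum>u\<in>S. wt G u w)" if "w \<in> S" "w \<in> nonsink G"
    proof -
      have "count_list vs w = 1"
        using that vs by (simp add: count_list_distinct)
      moreover have "(\<Sum>u\<in>nonsink G. count_list vs u * wt G u w) \<le> (\<Sum>u\<in>S. wt G u w)"
      proof -
        have "(\<Sum>u\<in>nonsink G. count_list vs u * wt G u w)
          \<le> (\<Sum>u\<in>nonsink G. if u \<in> S then wt G u w else 0)"
          using vs by (intro sum_mono) (auto simp: count_list_distinct)
        also have "\<dots> = (\<Sum>u\<in>nonsink G \<inter> S. wt G u w)"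
          using finite_nonsink by (simp add: sum.inter_restrict)
        also have "\<dots> \<le> (\<Sum>u\<in>S. wt G u w)"
          using fin by (intro sum_mono2) auto
        finally show ?thesis .
      qed
      ultimately show ?thesis using toppling_seq_balance[OF vs(3) that(2)] by simp
    qed
    then show "topple G v (fired G c S) w = fired G c (insert v S) w"
      using S(2) v fin no_loops by (auto simp: topple_def fired_def)
  qed
  then have "toppling_seq G (fired G c S) [v] (fired G c (insert v S))"
    using toppling_seq.Cons[OF un toppling_seq.Nil] by simp
  then have "toppling_seq G c (vs @ [v]) (fired G c (insert v S))"
    using toppling_seq_append vs(3) by blast
  then show ?thesis
    unfolding fires_def using vs S(2) by (intro exI[of _ "vs @ [v]"]) auto
qed

lemma toppling_vector_fires:
  assumes "fires G c S" "stable G (fired G c S)"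
  shows "toppling_vector G c = (\<lambda>v. if v \<in> S then 1 else 0)"
proof -
  obtain vs where vs: "distinct vs" "set vs = S" "toppling_seq G c vs (fired G c S)"
    using assms(1) by (auto simp: fires_def)
  show ?thesis
    using toppling_vector_eq[OF vs(3) assms(2)] vs by (simp add: fun_eq_iff count_list_distinct)
qed

end

section \<open>Forbidden sets and burning\<close>

definition forbidden :: "'v sink_graph \<Rightarrow> ('v \<Rightarrow> nat) \<Rightarrow> 'v set \<Rightarrow> bool" where
  "forbidden G c F \<longleftrightarrow> F \<noteq> {} \<and> F \<subseteq> nonsink G \<and> (\<forall>v\<in>F. c v < (\<Sum>u\<in>F. wt G u v))"

context sandpile_graph
begin

text \<open>Forbidden sets pull back along topplings. If \<open>v\<close> lies outside
  \<open>F\<close>, undoing the toppling only removes grains from \<open>F\<close>. If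
  \<open>v\<close> lies in \<open>F\<close>, drop it: every other \<open>u\<close> loses the
  \<open>wt G v u\<close> grains it received and exactly as many edges into the set, so the
  inequality persists.\<close>

lemma forbidden_topple:
  assumes "unstable G c v" "forbidden G (topple G v c) F"
  shows "\<exists>F'. forbidden G c F'"
proof (cases "v \<in> F")
  case False
  have "c u \<le> topple G v c u" if "u \<in> F" for u
    using that assms False by (auto simp: topple_def forbidden_def)
  then have "forbidden G c F"
    using assms(2) unfolding forbidden_def by (blast intro: le_less_trans)
  then show ?thesis ..
next
  case True
  have fin: "finite F"
    using assms(2) finite_nonsink by (auto simp: forbidden_def intro: finite_subset)
  have "F - {v} \<noteq> {}"
  proof
    assume "F - {v} = {}"
    with True have "F = {v}" by auto
    with assms(2) no_loops show False by (auto simp: forbidden_def)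
  qed
  moreover have "c u < (\<Sum>x\<in>F - {v}. wt G x u)" if "u \<in> F - {v}" for u
  proof -
    have "c u + wt G v u < (\<Sum>x\<in>F. wt G x u)"
      using that assms by (auto simp: forbidden_def topple_def split: if_splits)
    then show ?thesis using fin True by (simp add: sum.remove)
  qed
  ultimately have "forbidden G c (F - {v})"
    using assms(2) by (auto simp: forbidden_def)
  then show ?thesis ..
qed

lemma forbidden_toppling_seq:
  "toppling_seq G c vs c' \<Longrightarrow> forbidden G c' F \<Longrightarrow> \<exists>F'. forbidden G c F'"
  by (induction arbitrary: F rule: toppling_seq.induct) (use forbidden_topple in blast)+

lemma deg_split: 
  assumes "S \<subseteq> nonsink G"
  shows "deg G v = wt G (sink G) v + (\<Sum>u\<in>S. wt G u v) + (\<Sum>u\<in>nonsink G - S. wt G u v)"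
proof -
  have "deg G v = (\<Sum>u\<in>verts G. wt G u v)"
    unfolding deg_def by (intro sum.cong wt_sym refl)
  also have "\<dots> = wt G (sink G) v + (\<Sum>u\<in>nonsink G. wt G u v)"
    unfolding nonsink_def using finite_verts sink_in_verts by (rule sum.remove)
  also have "(\<Sum>u\<in>nonsink G. wt G u v) = (\<Sum>u\<in>S. wt G u v) + (\<Sum>u\<in>nonsink G - S. wt G u v)"
    using sum.subset_diff[OF assms finite_nonsink, of "\<lambda>u. wt G u v"] by simp
  finally show ?thesis by simp
qed

definition fire_sink :: "'v \<Rightarrow> nat" where
  "fire_sink v = (if v \<in> nonsink G then wt G (sink G) v else 0)"

lemma sandpile_fire_sink: "sandpile G fire_sink"
  by (simp add: sandpile_def fire_sink_def)

text \<open>Firing the sink and every other vertex once changes nothing, since each vertex gives as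
  much as it gets. A legal order is found greedily: the set of vertices not yet fired is not
  forbidden, so some \<open>v\<close> in it has at least as many grains as edges into that set, and
  the grains from the sink and from the fired vertices supply the rest of its degree.\<close>

lemma burning:
  assumes c: "sandpile G c" and nf: "\<And>F. \<not> forbidden G c F"
  shows "\<exists>vs. toppling_seq G (\<lambda>v. c v + fire_sink v) vs c"
proof -
  let ?c = "\<lambda>v. c v + fire_sink v"
  have "\<exists>S \<subseteq> nonsink G. fires G ?c S \<and> card S = k" if "k \<le> card (nonsink G)" for k
    using that
  proof (induction k)
    case 0
    have "sandpile G ?c" using c sandpile_fire_sink by (auto simp: sandpile_def)
    then show ?case by (intro exI[of _ "{}"]) (auto intro: fires_empty)
  next
    case (Suc k)
    then obtain S where S: "S \<subseteq> nonsink G" "fires G ?c S" "card S = k" by auto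
    have fin: "finite S" using S(1) finite_nonsink by (rule finite_subset)
    have "nonsink G - S \<noteq> {}" using S(1,3) Suc.prems by auto
    with nf[of "nonsink G - S"] obtain v
      where v: "v \<in> nonsink G - S" "(\<Sum>u\<in>nonsink G - S. wt G u v) \<le> c v"
      by (auto simp: forbidden_def not_less)
    have "deg G v \<le> ?c v + (\<Sum>u\<in>S. wt G u v)"
      using v deg_split[OF S(1), of v] by (simp add: fire_sink_def)
    then have "fires G ?c (insert v S)" using S v by (intro fires_insert) auto
    then show ?case using S v fin by (intro exI[of _ "insert v S"]) auto
  qed
  then obtain S where S: "S \<subseteq> nonsink G" "fires G ?c S" "card S = card (nonsink G)"
    by blast
  then have [simp]: "S = nonsink G" using finite_nonsink by (simp add: card_subset_eq)
  have "fired G ?c (nonsink G) = c"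
    using c deg_split[OF subset_refl] by (auto simp: fired_def fire_sink_def sandpile_def)
  with S(2) show ?thesis by (auto simp: fires_def)
qed

end

section \<open>Graphs whose sink is adjacent to every vertex\<close>

locale cone_graph = sandpile_graph +
  assumes sink_adjacent: "v \<in> nonsink G \<Longrightarrow> wt G (sink G) v > 0"
begin

text \<open>Each toppling loses at least one grain to the sink, so the total number of grains
  strictly decreases.\<close>

lemma stabilizes: "\<exists>vs c'. toppling_seq G c vs c' \<and> stable G c'"
proof (induction "\<Sum>v\<in>nonsink G. c v" arbitrary: c rule: less_induct)
  case less
  show ?case
  proof (cases "stable G c")
    case True
    then show ?thesis by (auto intro: toppling_seq.Nil)
  next
    case False
    then obtain v where v: "unstable G c v" by (auto simp: stable_def)
    then have vn: "v \<in> nonsink G" "deg G v \<le> c v" by (auto simp: unstable_def)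
    have "(\<Sum>w\<in>nonsink G. topple G v c w) + deg G v
        = (\<Sum>w\<in>nonsink G. topple G v c w + (if w = v then deg G v else 0))"
      using finite_nonsink vn by (simp add: sum.distrib)
    also have "\<dots> = (\<Sum>w\<in>nonsink G. c w + wt G v w)"
      using vn no_loops by (intro sum.cong) (auto simp: topple_def)
    also have "\<dots> = (\<Sum>w\<in>nonsink G. c w) + (\<Sum>w\<in>nonsink G. wt G w v)"
      by (simp add: sum.distrib wt_sym[of v])
    finally have "(\<Sum>w\<in>nonsink G. topple G v c w) < (\<Sum>w\<in>nonsink G. c w)"
      using deg_split[OF subset_refl, of v] sink_adjacent[OF vn(1)] by simp
    from less[OF this] v show ?thesis by (blast intro: toppling_seq.Cons)
  qed
qed

text \<open>Since the sink is adjacent to every vertex, firing it often enough dominates any given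
  sandpile, and burning returns the result to \<open>c\<close>.\<close>
lemma recurrent_iff:
  "recurrent G c \<longleftrightarrow> sandpile G c \<and> stable G c \<and> (\<forall>F. \<not> forbidden G c F)"
proof (intro iffI conjI allI; (elim conjE)?)
  assume r: "recurrent G c"
  then show "sandpile G c" "stable G c" by (auto simp: recurrent_def)
  fix F
  \<comment> \<open>A pile with \<open>deg G v\<close> grains at every vertex has no forbidden set,
    even after adding \<open>b\<close>. Recurrence reaches \<open>c\<close> from such a pile, and a
    forbidden set of \<open>c\<close> would pull back to it.\<close>
  let ?a = "\<lambda>v. if v \<in> nonsink G then deg G v else 0"
  have "sandpile G ?a" by (simp add: sandpile_def)
  with r obtain b where b: "sandpile G b" "sandpile_sum G ?a b = c"
    unfolding recurrent_def by blast
  let ?s = "\<lambda>v. ?a v + b v"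
  have "sandpile G ?s" using b by (simp add: sandpile_def)
  with stabilizes[of ?s] b(2) obtain vs where vs: "toppling_seq G ?s vs c"
    unfolding sandpile_sum_def using stabilization_eq by metis
  show "\<not> forbidden G c F"
  proof
    assume "forbidden G c F"
    from forbidden_toppling_seq[OF vs this] obtain F' where F': "forbidden G ?s F'" ..
    then obtain v where v: "v \<in> F'" "F' \<subseteq> nonsink G" by (auto simp: forbidden_def)
    with F' have "?s v < (\<Sum>u\<in>F'. wt G u v)" unfolding forbidden_def by blast
    with v deg_split[OF v(2), of v] show False by auto
  qed
next
  assume c: "sandpile G c" "stable G c" and nf: "\<forall>F. \<not> forbidden G c F"
  from burning[OF c(1)] nf obtain vs where vs: "toppling_seq G (\<lambda>v. c v + fire_sink v) vs c"
    by blast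
  have many: "\<exists>us. toppling_seq G (\<lambda>v. c v + k * fire_sink v) us c" for k
  proof (induction k)
    case 0
    show ?case by (auto intro: toppling_seq.Nil)
  next
    case (Suc k)
    then obtain us where us: "toppling_seq G (\<lambda>v. c v + k * fire_sink v) us c" ..
    from toppling_seq_add[OF us sandpile_fire_sink]
    have "toppling_seq G (\<lambda>v. c v + Suc k * fire_sink v) us (\<lambda>v. c v + fire_sink v)"
      by (simp add: algebra_simps)
    from toppling_seq_append[OF this vs] show ?case ..
  qed
  show "recurrent G c"
    unfolding recurrent_def
  proof (intro conjI c allI impI)
    fix a assume a: "sandpile G a"
    define k where "k = (\<Sum>v\<in>nonsink G. a v)"
    let ?d = "\<lambda>v. c v + k * fire_sink v"
    have le: "a v \<le> ?d v" for v
    proof (cases "v \<in> nonsink G")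
      case True
      have "a v \<le> k" unfolding k_def using finite_nonsink True by (intro member_le_sum) auto
      also have "k \<le> k * fire_sink v" using sink_adjacent[OF True] True by (simp add: fire_sink_def)
      finally show ?thesis by simp
    next
      case False
      then show ?thesis using a by (simp add: sandpile_def)
    qed
    have d: "sandpile G ?d" using c(1) sandpile_fire_sink by (simp add: sandpile_def)
    obtain us where "toppling_seq G ?d us c" using many by blast
    then have "stabilization G ?d = c" by (intro stabilization_eq d c)
    then have "sandpile_sum G a (\<lambda>v. ?d v - a v) = c"
      using le by (simp add: sandpile_sum_def)
    moreover have "sandpile G (\<lambda>v. ?d v - a v)" using d by (auto simp: sandpile_def)
    ultimately show "\<exists>b. sandpile G b \<and> sandpile_sum G a b = c" by blast
  qed
qed

end

section \<open>Recurrent sandpiles on the wheel\<close>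

text \<open>Positions may be arbitrary naturals, so cyclic segments become ordinary
  intervals.\<close>

definition rim :: "nat \<Rightarrow> nat \<Rightarrow> wheel_vertex" where
  "rim n k = Rim (k mod n)"

text \<open>A state says whether the last letter different from \<open>1\<close> that was read is a \<open>2\<close>
  (rather than a \<open>0\<close>).\<close>

fun step :: "bool \<Rightarrow> nat \<Rightarrow> bool \<Rightarrow> bool" where
  "step p x q \<longleftrightarrow> x = 2 \<and> q \<or> x = 1 \<and> q = p \<or> x = 0 \<and> p \<and> \<not> q"

fun path :: "bool \<Rightarrow> nat list \<Rightarrow> bool \<Rightarrow> bool" where
  "path p [] q \<longleftrightarrow> p = q"
| "path p (x # w) q \<longleftrightarrow> (\<exists>r. step p x r \<and> path r w q)"

text \<open>A closed walk of the automaton expresses the cyclic reading. The all-ones word also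
  closes up but contains no 2, so it is excluded by hand; any other closed walk does read a 2,
  because after a 0 only a 2 restores the state \<open>True\<close>.\<close>

definition good :: "nat list \<Rightarrow> bool" where
  "good w \<longleftrightarrow> (\<exists>p. path p w p) \<and> (\<exists>x\<in>set w. x \<noteq> 1)"

text \<open>States indexed by position can be rotated and continued periodically, which the
  recursive form does not allow directly.\<close>

lemma path_iff_states:
  "path p w q \<longleftrightarrow> (\<exists>s. s 0 = p \<and> s (length w) = q \<and> (\<forall>k<length w. step (s k) (w ! k) (s (Suc k))))"
proof (induction w arbitrary: p)
  case Nil
  show ?case (is "?L \<longleftrightarrow> ?R")
  proof
    show "?L \<Longrightarrow> ?R" by (rule exI[of _ "\<lambda>_. q"]) simp
    show "?R \<Longrightarrow> ?L" by (elim exE conjE) simp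
  qed
next
  case (Cons x w)
  show ?case (is "?L \<longleftrightarrow> ?R")
  proof
    assume ?L
    then obtain r where r: "step p x r" "path r w q" by auto
    from r(2) obtain s where s: "s 0 = r" "s (length w) = q"
      "\<forall>k<length w. step (s k) (w ! k) (s (Suc k))" unfolding Cons.IH by (elim exE conjE)
    define t where "t = case_nat p s"
    have t: "t 0 = p" "t (Suc k) = s k" for k by (simp_all add: t_def)
    have "step (t k) ((x # w) ! k) (t (Suc k))" if "k < length (x # w)" for k
      using that r(1) s by (cases k) (simp_all add: t del: step.simps)
    then have "t 0 = p \<and> t (length (x # w)) = q \<and>
        (\<forall>k<length (x # w). step (t k) ((x # w) ! k) (t (Suc k)))"
      using s(2) t by simp
    then show ?R by (rule exI[of _ t])
  next
    assume ?R
    then obtain s where s: "s 0 = p" "s (length (x # w)) = q"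
      "\<forall>k<length (x # w). step (s k) ((x # w) ! k) (s (Suc k))" by (elim exE conjE)
    have "step (s (Suc k)) (w ! k) (s (Suc (Suc k)))" if "k < length w" for k
      using s(3)[rule_format, of "Suc k"] that by (simp del: step.simps)
    then have "path (s (Suc 0)) w q"
      unfolding Cons.IH using s(2) by (intro exI[of _ "\<lambda>k. s (Suc k)"]) (simp del: step.simps)
    moreover have "step p x (s (Suc 0))" using s(3)[rule_format, of 0] s(1) by (simp del: step.simps)
    ultimately show ?L unfolding path.simps by blast
  qed
qed

section \<open>Cyclic positions and edge weights\<close>

definition word :: "nat \<Rightarrow> (wheel_vertex \<Rightarrow> nat) \<Rightarrow> nat \<Rightarrow> nat list" where
  "word n c i = map (\<lambda>k. c (rim n (i + k))) [0..<n]"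

lemma length_word [simp]: "length (word n c i) = n"
  by (simp add: word_def)

lemma nth_word: "k < n \<Longrightarrow> word n c i ! k = c (rim n (i + k))"
  by (simp add: word_def)

lemma rim_add_mult: "rim n (k + n * j) = rim n k"
  by (simp add: rim_def)

lemma rim_add_period: "rim n (k + n) = rim n k"
  by (simp add: rim_def)

lemma nonsink_wheel: "nonsink (wheel n) = Rim ` {..<n}"
  by (auto simp: nonsink_def wheel_def)

locale wheel_graph =
  fixes n :: nat
  assumes n_ge: "n \<ge> 3"
begin

sublocale cone_graph "wheel n"
proof -
  interpret sandpile_graph "wheel n" by (rule sandpile_graph_wheel[OF n_ge])
  show "cone_graph (wheel n)"
    by unfold_locales (auto simp: nonsink_wheel, auto simp: wheel_def)
qed

lemma rim_nonsink [simp]: "rim n k \<in> nonsink (wheel n)"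
  using n_ge by (simp add: nonsink_wheel rim_def)

text \<open>A representative beyond any prescribed bound makes predecessors and distances available
  in the naturals.\<close>

lemma nonsink_obtain:
  assumes "v \<in> nonsink (wheel n)"
  obtains k where "k \<ge> m" "v = rim n k"
proof -
  from assms obtain j where "j < n" "v = Rim j" by (auto simp: nonsink_wheel)
  then have "v = rim n (j + n * m)" by (simp add: rim_def)
  moreover have "j + n * m \<ge> m" using n_ge by (cases n) auto
  ultimately show thesis by (rule that[rotated])
qed

lemma rim_eq_iff:
  assumes "p \<le> j" "j < p + n" "p \<le> k" "k < p + n"
  shows "rim n j = rim n k \<longleftrightarrow> j = k"
proof
  assume "rim n j = rim n k"
  then have eq: "j mod n = k mod n" by (simp add: rim_def)
  show "j = k"
  proof (cases "j \<le> k")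
    case True
    with eq have "n dvd k - j" by (metis mod_eq_dvd_iff_nat)
    with True assms show ?thesis using nat_dvd_not_less[of "k - j" n] by linarith
  next
    case False
    with eq have "n dvd j - k" by (metis mod_eq_dvd_iff_nat nat_le_linear)
    with False assms show ?thesis using nat_dvd_not_less[of "j - k" n] by linarith
  qed
qed simp

text \<open>Centring at \<open>Suc k\<close> names both neighbours, \<open>k\<close> and
  \<open>k + 2\<close>, without a predecessor. They are distinct because \<open>n \<ge> 3\<close>;
  otherwise the right side would count one edge twice.\<close>

lemma wt_rim:
  "wt (wheel n) u (rim n (Suc k)) =
     of_bool (u = Hub) + of_bool (u = rim n k) + of_bool (u = rim n (k + 2))"
proof (cases u)
  case Hub
  then show ?thesis using n_ge by (simp add: wheel_def rim_def)
next
  case (Rim j)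
  have ne: "k mod n \<noteq> (k + 2) mod n"
    using rim_eq_iff[of k k "k + 2"] n_ge by (auto simp: rim_def)
  have "Suc k mod n = Suc j mod n \<longleftrightarrow> j = k mod n" if "j < n"
    using that n_ge by (auto simp: mod_Suc)
  moreover have "Suc (Suc k mod n) mod n = (k + 2) mod n"
    by (simp add: mod_Suc_eq)
  ultimately show ?thesis using Rim ne n_ge by (auto simp: wheel_def rim_def)
qed

lemma sum_wt_rim:
  assumes "S \<subseteq> nonsink (wheel n)"
  shows "(\<Sum>u\<in>S. wt (wheel n) u (rim n (Suc k)))
    = of_bool (rim n k \<in> S) + of_bool (rim n (k + 2) \<in> S)"
proof -
  have fin: "finite S" using assms finite_nonsink by (rule finite_subset)
  have one: "(\<Sum>u\<in>S. of_bool (u = v)) = (of_bool (v \<in> S) :: nat)" for v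
    using fin by (simp add: of_bool_def)
  have "Hub \<notin> S" using assms by (auto simp: nonsink_wheel)
  then show ?thesis by (simp add: wt_rim sum.distrib one)
qed

lemma deg_rim [simp]: "deg (wheel n) (rim n k) = 3"
proof -
  obtain j where j: "j \<ge> 1" "rim n k = rim n j" using nonsink_obtain[OF rim_nonsink, of 1 k] by metis
  then obtain l where l: "rim n k = rim n (Suc l)" by (cases j) auto
  have "wt (wheel n) (sink (wheel n)) (rim n (Suc l)) = 1"
    unfolding wt_rim by (simp add: wheel_def rim_def)
  then show ?thesis
    using deg_split[OF subset_refl, of "rim n (Suc l)"] sum_wt_rim[OF subset_refl, of l] l by simp
qed

section \<open>Forbidden sets versus closed walks of the automaton\<close>

lemma forbiddenD:
  assumes "forbidden (wheel n) c F" "rim n (Suc k) \<in> F"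
  shows "c (rim n (Suc k)) < of_bool (rim n k \<in> F) + of_bool (rim n (k + 2) \<in> F)"
proof -
  have "F \<subseteq> nonsink (wheel n)" "c (rim n (Suc k)) < (\<Sum>u\<in>F. wt (wheel n) u (rim n (Suc k)))"
    using assms unfolding forbidden_def by blast+
  then show ?thesis by (simp only: sum_wt_rim)
qed

text \<open>If the whole rim is forbidden, every letter is below 2, so a state \<open>False\<close>
  persists and admits only ones; if all states are \<open>True\<close>, no 0 is read and again only
  ones remain. A smaller forbidden set has a left border, and walking right from it never leaves the
  set, which is absurd after one full turn.\<close>

lemma not_forbidden_if_states:
  assumes step: "\<And>k. step (s k) (c (rim n k)) (s (Suc k))"
    and ne1: "v \<in> nonsink (wheel n)" "c v \<noteq> 1"
  shows "\<not> forbidden (wheel n) c F"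
proof
  assume F: "forbidden (wheel n) c F"
  then have F': "F \<noteq> {}" "F \<subseteq> nonsink (wheel n)" by (auto simp: forbidden_def)
  show False
  proof (cases "F = nonsink (wheel n)")
    case True
    have lt2: "c u < 2" if u: "u \<in> nonsink (wheel n)" for u
    proof -
      obtain k where "k \<ge> 1" "u = rim n k" using nonsink_obtain[OF u] by metis
      then obtain l where "u = rim n (Suc l)" by (cases k) auto
      then show ?thesis using forbiddenD[OF F, of l] True by simp
    qed
    show False
    proof (cases "\<exists>k0. \<not> s k0")
      case True
      then obtain k0 where k0: "\<not> s k0" ..
      have neg: "\<not> s (k0 + d)" for d
      proof (induction d)
        case (Suc d)
        then show ?case using step[of "k0 + d"] lt2[of "rim n (k0 + d)"] by auto
      qed (use k0 in simp)
      obtain k where k: "k \<ge> k0" "v = rim n k" using nonsink_obtain[OF ne1(1)] by metis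
      then have "\<not> s k" "\<not> s (Suc k)" using neg[of "k - k0"] neg[of "Suc k - k0"] by auto
      then show False using step[of k] lt2[OF ne1(1)] ne1(2) k by auto
    next
      case False
      obtain k where k: "v = rim n k" using nonsink_obtain[OF ne1(1)] by metis
      then show False using False step[of k] lt2[OF ne1(1)] ne1(2) by auto
    qed
  next
    case False
    have "\<exists>k. rim n k \<notin> F \<and> rim n (Suc k) \<in> F"
    proof (rule ccontr)
      assume neg: "\<nexists>k. rim n k \<notin> F \<and> rim n (Suc k) \<in> F"
      obtain u where u: "u \<in> nonsink (wheel n)" "u \<notin> F" using False F'(2) by auto
      obtain k where k: "u = rim n k" using nonsink_obtain[OF u(1)] by metis
      have out: "rim n (k + d) \<notin> F" for d
        by (induction d) (use neg u k in auto)
      obtain x where x: "x \<in> F" using F'(1) by auto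
      then obtain l where "l \<ge> k" "x = rim n l" using nonsink_obtain F'(2) by (metis subsetD)
      with out[of "l - k"] x show False by simp
    qed
    then obtain k where k: "rim n k \<notin> F" "rim n (Suc k) \<in> F" by auto
    \<comment> \<open>At \<open>d = 0\<close> the left neighbour is outside \<open>F\<close>, so the
      letter is 0, the right neighbour is in \<open>F\<close> and the state drops to
      \<open>False\<close>. From then on a 0 cannot be read, and a 1 again forces the right
      neighbour into \<open>F\<close>.\<close>
    have "rim n (Suc (k + d)) \<in> F \<and> (d > 0 \<longrightarrow> \<not> s (Suc (k + d)))" for d
    proof (induction d)
      case (Suc d)
      have "c (rim n (Suc (k + d))) < of_bool (rim n (k + d) \<in> F) + of_bool (rim n (k + d + 2) \<in> F)"
        using forbiddenD[OF F] Suc.IH by blast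
      then show ?case
        using Suc.IH k step[of "Suc (k + d)"] by (cases d) (auto simp: of_bool_def split: if_splits)
    qed (use k in simp)
    from this[of "n - 1"] k rim_add_period[of n k] n_ge show False by simp
  qed
qed

text \<open>The only way the automaton can get stuck on a stable pile is to read a 0 when the
  previous letter other than 1 is also a 0. Those two zeros and the ones between them form a
  forbidden set.\<close>

lemma states_if_no_forbidden:
  assumes st: "stable (wheel n) c" and nf: "\<And>F. \<not> forbidden (wheel n) c F"
  obtains s where "\<And>k. step (s k) (c (rim n k)) (s (Suc k))" "\<And>k. s (k + n) = s k"
proof -
  \<comment> \<open>Looks back at most one full turn; \<open>n\<close> is added first so that
    subtracting \<open>d\<close> never truncates.\<close>
  define s where "s k \<longleftrightarrow> (\<exists>d\<in>{1..n}. c (rim n (k + n - d)) = 2 \<and>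
      (\<forall>e\<in>{1..<d}. c (rim n (k + n - e)) = 1))" for k
  have "s (k + n) = s k" for k
  proof -
    have "rim n (k + n + n - d) = rim n (k + n - d)" if "d \<le> n" for d
      using that rim_add_period[of n "k + n - d"] by simp
    then show ?thesis unfolding s_def by (intro bex_cong) auto
  qed
  moreover have "step (s k) (c (rim n k)) (s (Suc k))" for k
  proof -
    have "\<not> unstable (wheel n) c (rim n k)" using st by (simp add: stable_def)
    then have "c (rim n k) < 3" by (simp add: unstable_def)
    then consider "c (rim n k) = 2" | "c (rim n k) = 1" | "c (rim n k) = 0" by linarith
    then show ?thesis
    proof cases
      case 1
      then have "s (Suc k)" unfolding s_def
        using n_ge rim_add_period[of n k] by (intro bexI[of _ 1]) auto
      with 1 show ?thesis by simp
    next
      case 2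
      have "s (Suc k) = s k"
      proof
        assume "s (Suc k)"
        then obtain d where d: "d \<in> {1..n}" "c (rim n (Suc k + n - d)) = 2"
          "\<forall>e\<in>{1..<d}. c (rim n (Suc k + n - e)) = 1" by (auto simp: s_def)
        have "d \<noteq> 1" using d(2) 2 rim_add_period[of n k] by auto
        then obtain d' where d': "d = Suc d'" "d' \<ge> 1" using d(1) by (cases d) auto
        have "c (rim n (k + n - e)) = 1" if "e \<in> {1..<d'}" for e
          using d(3)[rule_format, of "Suc e"] that d' by simp
        with d d' show "s k" unfolding s_def by (intro bexI[of _ d']) auto
      next
        assume "s k"
        then obtain d where d: "d \<in> {1..n}" "c (rim n (k + n - d)) = 2"
          "\<forall>e\<in>{1..<d}. c (rim n (k + n - e)) = 1" by (auto simp: s_def)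
        \<comment> \<open>At distance \<open>n\<close> stands the letter at \<open>k\<close> itself,
          which is 1; hence \<open>Suc d\<close> still fits within one turn.\<close>
        have "d \<noteq> n" using d(2) 2 by auto
        have "c (rim n (Suc k + n - e)) = 1" if "e \<in> {1..<Suc d}" for e
        proof (cases "e = 1")
          case True
          then show ?thesis using 2 rim_add_period[of n k] by simp
        next
          case False
          then obtain e' where "e = Suc e'" using \<open>e \<in> {1..<Suc d}\<close> by (cases e) auto
          then show ?thesis using False d(3)[rule_format, of e'] that by simp
        qed
        with d \<open>d \<noteq> n\<close> show "s (Suc k)" unfolding s_def by (intro bexI[of _ "Suc d"]) auto
      qed
      with 2 show ?thesis by simp
    next
      case 3
      have "\<not> s (Suc k)"
      proof
        assume "s (Suc k)"
        then obtain d where d: "d \<in> {1..n}" "c (rim n (Suc k + n - d)) = 2"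
          "\<forall>e\<in>{1..<d}. c (rim n (Suc k + n - e)) = 1" by (auto simp: s_def)
        show False
        proof (cases "d = 1")
          case True
          then show False using d(2) 3 rim_add_period[of n k] by simp
        next
          case False
          then show False using d(1) d(3)[rule_format, of 1] 3 rim_add_period[of n k] by simp
        qed
      qed
      moreover have "s k"
      proof (rule ccontr)
        assume ns: "\<not> s k"
        define d where "d = (LEAST d. d \<ge> 1 \<and> c (rim n (k + n - d)) \<noteq> 1)"
        \<comment> \<open>The 0 at \<open>k\<close>, met again one turn back, guarantees that the
          search ends with \<open>d\<close> at most \<open>n\<close>.\<close>
        have ex: "n \<ge> 1 \<and> c (rim n (k + n - n)) \<noteq> 1" using 3 n_ge by simp
        have d: "d \<ge> 1" "c (rim n (k + n - d)) \<noteq> 1"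
          using LeastI[of "\<lambda>d. d \<ge> 1 \<and> c (rim n (k + n - d)) \<noteq> 1", OF ex] by (simp_all add: d_def)
        have dn: "d \<le> n" unfolding d_def using ex by (rule Least_le)
        have between: "c (rim n (k + n - e)) = 1" if "e \<in> {1..<d}" for e
          using not_less_Least[of e "\<lambda>d. d \<ge> 1 \<and> c (rim n (k + n - d)) \<noteq> 1"] that
          unfolding d_def by auto
        have "c (rim n (k + n - d)) \<noteq> 2"
        proof
          assume "c (rim n (k + n - d)) = 2"
          then have "s k" unfolding s_def using d dn between by (intro bexI[of _ d]) auto
          with ns show False ..
        qed
        moreover have "\<not> unstable (wheel n) c (rim n (k + n - d))" using st by (simp add: stable_def)
        then have "c (rim n (k + n - d)) < 3" by (simp add: unstable_def)
        ultimately have d0: "c (rim n (k + n - d)) = 0" using d by linarith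
        \<comment> \<open>Each end has no grain but a neighbour in \<open>F\<close>; each inner
          vertex has one grain and two neighbours in \<open>F\<close>. For \<open>d = n\<close> both
          ends are the same vertex and \<open>F\<close> is the whole rim.\<close>
        define F where "F = rim n ` {k + n - d..k + n}"
        have sub: "F \<subseteq> nonsink (wheel n)" by (auto simp: F_def)
        have "c v < (\<Sum>u\<in>F. wt (wheel n) u v)" if vF: "v \<in> F" for v
        proof -
          obtain j where j: "k + n - d \<le> j" "j \<le> k + n" "v = rim n j" using vF by (auto simp: F_def)
          have "v = rim n (Suc (j + (n - 1)))" using j(3) n_ge rim_add_period[of n j] by simp
          then have sum: "(\<Sum>u\<in>F. wt (wheel n) u v)
              = of_bool (rim n (j + (n - 1)) \<in> F) + of_bool (rim n (Suc j) \<in> F)"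
            using sum_wt_rim[OF sub, of "j + (n - 1)"] rim_add_period[of n "Suc j"] n_ge
            by (simp add: numeral_2_eq_2)
          have left: "rim n (j + (n - 1)) \<in> F" if "k + n - d < j"
          proof -
            have "j + (n - 1) = (j - 1) + n" using that n_ge by simp
            then have "rim n (j + (n - 1)) = rim n (j - 1)" using rim_add_period by metis
            moreover have "j - 1 \<in> {k + n - d..k + n}" using that j by auto
            ultimately show ?thesis unfolding F_def by blast
          qed
          have right: "rim n (Suc j) \<in> F" if "j < k + n"
            using that j by (auto simp: F_def)
          consider "j = k + n - d" | "j = k + n" "k + n - d < j" | "k + n - d < j" "j < k + n"
            using j by linarith
          then show ?thesis
          proof cases
            case 1
            then show ?thesis using d0 j sum right d(1) dn by simp
          next
            case 2
            then show ?thesis using \<open>c (rim n k) = 0\<close> j sum left rim_add_period[of n k] by simp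
          next
            case 3
            then have "k + n - j \<in> {1..<d}" using dn unfolding atLeastLessThan_iff by linarith
            then have "c v = 1" using between[of "k + n - j"] j by simp
            then show ?thesis using 3 sum left right by simp
          qed
        qed
        moreover have "F \<noteq> {}" by (simp add: F_def)
        ultimately have "forbidden (wheel n) c F" using sub by (simp add: forbidden_def)
        with nf show False by blast
      qed
      ultimately show ?thesis using 3 by simp
    qed
  qed
  ultimately show thesis by (rule that[rotated])
qed

text \<open>The starting position \<open>i\<close> is free, so the word may be read from whichever
  vertex receives the grain.\<close>

lemma recurrent_iff_good:
  assumes "sandpile (wheel n) c"
  shows "recurrent (wheel n) c \<longleftrightarrow> good (word n c i)"
proof
  assume "recurrent (wheel n) c"
  then have st: "stable (wheel n) c" and nf: "\<And>F. \<not> forbidden (wheel n) c F"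
    by (auto simp: recurrent_iff)
  obtain s where s: "\<And>k. step (s k) (c (rim n k)) (s (Suc k))" "\<And>k. s (k + n) = s k"
    using states_if_no_forbidden[OF st nf] by blast
  have "path (s i) (word n c i) (s i)"
    unfolding path_iff_states using s(1)[of "i + k" for k] s(2)[of i]
    by (intro exI[of _ "\<lambda>k. s (i + k)"]) (auto simp: nth_word)
  moreover have "\<exists>x\<in>set (word n c i). x \<noteq> 1"
  proof (rule ccontr)
    assume neg: "\<not> ?thesis"
    have "c v = 1" if v: "v \<in> nonsink (wheel n)" for v
    proof -
      obtain k where k: "k \<ge> i" "v = rim n k" using nonsink_obtain[OF v] by metis
      have "v = rim n (i + (k - i) mod n)" using k by (simp add: rim_def mod_add_right_eq)
      moreover have "word n c i ! ((k - i) mod n) \<in> set (word n c i)" using n_ge by (intro nth_mem) simp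
      ultimately show ?thesis using neg n_ge by (simp add: nth_word)
    qed
    then have "c v < (\<Sum>u\<in>nonsink (wheel n). wt (wheel n) u v)" if v: "v \<in> nonsink (wheel n)" for v
    proof -
      obtain k where "k \<ge> 1" "v = rim n k" using nonsink_obtain[OF v] by metis
      then obtain l where "v = rim n (Suc l)" by (cases k) auto
      then show ?thesis using sum_wt_rim[OF subset_refl, of l] \<open>\<And>v. v \<in> _ \<Longrightarrow> c v = 1\<close> by simp
    qed
    then have "forbidden (wheel n) c (nonsink (wheel n))"
      using rim_nonsink unfolding forbidden_def by blast
    with nf show False by blast
  qed
  ultimately show "good (word n c i)" by (auto simp: good_def)
next
  assume g: "good (word n c i)"
  then obtain p where "path p (word n c i) p" by (auto simp: good_def)
  then obtain s where s: "s 0 = p" "s n = p"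
    "\<And>k. k < n \<Longrightarrow> step (s k) (word n c i ! k) (s (Suc k))"
    unfolding path_iff_states by auto
  \<comment> \<open>\<open>(n - 1) * i\<close> stands for \<open>- i\<close> modulo
    \<open>n\<close>, undoing the rotation; the continuation is consistent across a full turn
    because \<open>s 0 = s n\<close>.\<close>
  define t where "t k = s ((k + (n - 1) * i) mod n)" for k
  have "step (t k) (c (rim n k)) (t (Suc k))" for k
  proof -
    define j where "j = (k + (n - 1) * i) mod n"
    have j: "j < n" using n_ge by (simp add: j_def)
    have "rim n (i + j) = rim n (i + (k + (n - 1) * i))"
      by (simp add: rim_def j_def mod_add_right_eq)
    also have "i + (k + (n - 1) * i) = k + n * i" using n_ge by (cases n) auto
    finally have "rim n (i + j) = rim n k" by (simp add: rim_add_mult)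
    moreover have "t (Suc k) = s (Suc j)"
      using s(1,2) by (auto simp: t_def j_def mod_Suc)
    moreover have "t k = s j" by (simp add: t_def j_def)
    ultimately show ?thesis using s(3)[OF j] j by (simp add: nth_word del: step.simps)
  qed
  moreover obtain k where "c (rim n k) \<noteq> 1"
    using g by (auto simp: good_def word_def)
  ultimately have nf: "\<not> forbidden (wheel n) c F" for F
    using not_forbidden_if_states rim_nonsink by blast
  have "stable (wheel n) c"
    unfolding stable_def unstable_def
  proof (intro allI notI, elim conjE)
    fix v assume v: "v \<in> nonsink (wheel n)" "deg (wheel n) v \<le> c v"
    then obtain k where k: "v = rim n k" using nonsink_obtain by metis
    with \<open>\<And>k. step (t k) (c (rim n k)) (t (Suc k))\<close>[of k] v(2) show False by auto
  qed
  with assms nf show "recurrent (wheel n) c" by (simp add: recurrent_iff)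
qed

end

section \<open>Avalanches on the wheel\<close>

definition arc :: "nat \<Rightarrow> nat \<Rightarrow> nat \<Rightarrow> wheel_vertex set" where
  "arc n p m = rim n ` {p..<p + m}"

context wheel_graph
begin

lemma arc_nonsink: "arc n p m \<subseteq> nonsink (wheel n)"
  by (auto simp: arc_def)

lemma rim_in_arc:
  assumes "m \<le> n" "p \<le> j" "j < p + n"
  shows "rim n j \<in> arc n p m \<longleftrightarrow> j < p + m"
proof
  assume "rim n j \<in> arc n p m"
  then obtain k where "p \<le> k" "k < p + m" "rim n j = rim n k" by (auto simp: arc_def)
  then show "j < p + m" using rim_eq_iff[of p j k] assms by simp
qed (use assms in \<open>auto simp: arc_def\<close>)

lemma arc_full: "arc n p n = nonsink (wheel n)"
proof
  show "nonsink (wheel n) \<subseteq> arc n p n"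
  proof
    fix v assume v: "v \<in> nonsink (wheel n)"
    obtain k where k: "k \<ge> p" "v = rim n k" using nonsink_obtain[OF v] by metis
    have "v = rim n (p + (k - p) mod n)" using k by (simp add: rim_def mod_add_right_eq)
    moreover have "p + (k - p) mod n \<in> {p..<p + n}" using n_ge by simp
    ultimately show "v \<in> arc n p n" unfolding arc_def by blast
  qed
qed (rule arc_nonsink)

lemma arc_Suc_right: "arc n p (Suc m) = insert (rim n (p + m)) (arc n p m)"
  by (simp add: arc_def atLeastLessThanSuc)

lemma arc_Suc_left: "arc n p (Suc m) = insert (rim n p) (arc n (Suc p) m)"
proof -
  have "{p..<p + Suc m} = insert p {Suc p..<Suc p + m}" by auto
  then show ?thesis by (simp only: arc_def image_insert)
qed

lemma sum_wt_arc:
  "(\<Sum>u\<in>arc n p m. wt (wheel n) u (rim n (Suc k)))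
    = of_bool (rim n k \<in> arc n p m) + of_bool (rim n (k + 2) \<in> arc n p m)"
  by (rule sum_wt_rim[OF arc_nonsink])

text \<open>The left neighbour has toppled, and its grain raises two grains to the degree 3.\<close>

lemma fires_arc_Suc_right:
  assumes "fires (wheel n) g (arc n p m)" "1 \<le> m" "m < n" "2 \<le> g (rim n (p + m))"
  shows "fires (wheel n) g (arc n p (Suc m))"
  unfolding arc_Suc_right
proof (rule fires_insert[OF assms(1)])
  show "rim n (p + m) \<notin> arc n p m" using assms(2,3) by (simp add: rim_in_arc)
  obtain l where l: "p + m = Suc l" using assms(2) by (cases "p + m") auto
  have "rim n l \<in> arc n p m" using l assms(2,3) by (simp add: rim_in_arc)
  then show "deg (wheel n) (rim n (p + m))
      \<le> g (rim n (p + m)) + (\<Sum>u\<in>arc n p m. wt (wheel n) u (rim n (p + m)))"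
    using assms(4) sum_wt_arc[of l p m] l by simp
qed simp

lemma fires_arc_Suc_left:
  assumes "fires (wheel n) g (arc n (Suc p) m)" "1 \<le> m" "m < n" "2 \<le> g (rim n p)"
  shows "fires (wheel n) g (arc n p (Suc m))"
  unfolding arc_Suc_left
proof (rule fires_insert[OF assms(1)])
  show "rim n p \<notin> arc n (Suc p) m"
    using assms(2,3) rim_in_arc[of m "Suc p" "p + n"] by (simp add: rim_add_period)
  have "rim n (Suc p) \<in> arc n (Suc p) m" using assms(2,3) by (simp add: rim_in_arc)
  \<comment> \<open>\<open>p\<close> may be 0, so its left neighbour is written as
    \<open>p + (n - 1)\<close>.\<close>
  moreover have "rim n p = rim n (Suc (p + (n - 1)))" "rim n (p + (n - 1) + 2) = rim n (Suc p)"
    using n_ge rim_add_period[of n p] rim_add_period[of n "Suc p"] by (simp_all add: numeral_2_eq_2)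
  ultimately show "deg (wheel n) (rim n p)
      \<le> g (rim n p) + (\<Sum>u\<in>arc n (Suc p) m. wt (wheel n) u (rim n p))"
    using assms(4) sum_wt_arc[of "p + (n - 1)" "Suc p" m] by simp
qed simp

lemma fires_arc_right:
  assumes "fires (wheel n) g (arc n p 1)" "1 \<le> a" "a \<le> n" "\<And>t. t < a \<Longrightarrow> 2 \<le> g (rim n (p + t))"
  shows "fires (wheel n) g (arc n p a)"
  using assms(2-4)
proof (induction a rule: nat_induct_at_least)
  case base
  show ?case by (rule assms(1))
next
  case (Suc a)
  then show ?case by (intro fires_arc_Suc_right) auto
qed

lemma fires_arc_left:
  assumes "fires (wheel n) g (arc n (p + b) a)" "1 \<le> a" "a + b \<le> n"
    "\<And>t. t < b \<Longrightarrow> 2 \<le> g (rim n (p + t))"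
  shows "fires (wheel n) g (arc n p (a + b))"
  using assms(1,3,4)
proof (induction b arbitrary: p)
  case (Suc b)
  have "fires (wheel n) g (arc n (Suc p) (a + b))"
    using Suc.prems(1,2) Suc.prems(3)[of "Suc t" for t] by (intro Suc.IH) auto
  then have "fires (wheel n) g (arc n p (Suc (a + b)))"
    using assms(2) Suc.prems(2) Suc.prems(3)[of 0] by (intro fires_arc_Suc_left) auto
  then show ?case by simp
qed simp

text \<open>A vertex of the arc has at most 3 grains, gets at most 2 and loses 3. Outside, only the
  two vertices bordering the arc gain a grain; for \<open>m = n - 1\<close> they coincide, which is
  why both indicators are added for the same \<open>j\<close>.\<close>

lemma stable_fired_arc:
  assumes le3: "\<And>v. g v \<le> 3" and m: "1 \<le> m" "m \<le> n" and p: "1 \<le> p"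
    and out: "\<And>j. p + m \<le> j \<Longrightarrow> j < p + n \<Longrightarrow>
      g (rim n j) + of_bool (j = p + m) + of_bool (j = p + n - 1) \<le> 2"
  shows "stable (wheel n) (fired (wheel n) g (arc n p m))"
  unfolding stable_def unstable_def
proof (intro allI notI, elim conjE)
  fix v
  assume v: "v \<in> nonsink (wheel n)" "deg (wheel n) v \<le> fired (wheel n) g (arc n p m) v"
  then have "v \<in> arc n p n" by (simp add: arc_full)
  then obtain j where j: "p \<le> j" "j < p + n" "v = rim n j" by (auto simp: arc_def)
  then obtain l where l: "j = Suc l" using p by (cases j) auto
  have sum: "(\<Sum>u\<in>arc n p m. wt (wheel n) u v)
      = of_bool (rim n l \<in> arc n p m) + of_bool (rim n (l + 2) \<in> arc n p m)"
    using sum_wt_arc[of l p m] j l by simp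
  show False
  proof (cases "j < p + m")
    case True
    then have "v \<in> arc n p m" using j m by (simp add: rim_in_arc)
    moreover have "(of_bool (rim n l \<in> arc n p m) + of_bool (rim n (l + 2) \<in> arc n p m) :: nat) \<le> 2"
      by simp
    ultimately show False using v le3[of v] sum j(3) by (simp add: fired_def)
  next
    case False
    then have "v \<notin> arc n p m" using j m by (simp add: rim_in_arc)
    moreover have "rim n l \<in> arc n p m \<longleftrightarrow> j = p + m"
      using False j l m rim_in_arc[of m p l] by auto
    moreover have "rim n (l + 2) \<in> arc n p m \<longleftrightarrow> j = p + n - 1"
    proof (cases "j = p + n - 1")
      case True
      then have "l + 2 = p + n" using l n_ge by linarith
      then have "rim n (l + 2) = rim n p" by (simp only: rim_add_period)
      then show ?thesis using True m n_ge by (simp add: rim_in_arc)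
    next
      case neq: False
      then show ?thesis using False j l m by (simp add: rim_in_arc)
    qed
    ultimately show False using v out[of j] False j sum by (simp add: fired_def)
  qed
qed

lemma add_grain_rim:
  "k < n \<Longrightarrow> add_grain c (rim n i) (rim n (i + k)) = word n c i ! k + of_bool (k = 0)"
  using rim_eq_iff[of i "i + k" i] n_ge by (auto simp: add_grain_def nth_word)

section \<open>Monomials of avalanches\<close>

definition arc_monomial :: "nat \<Rightarrow> nat \<Rightarrow> wheel_vertex int_mpoly" where
  "arc_monomial p m = (\<Prod>k<m. var (rim n (p + k)))"

lemma avalanche_monomial_fires:
  assumes "fires (wheel n) (add_grain c v) (arc n p m)" "m \<le> n"
    "stable (wheel n) (fired (wheel n) (add_grain c v) (arc n p m))"
  shows "avalanche_monomial (wheel n) c v = arc_monomial p m"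
proof -
  have "avalanche_monomial (wheel n) c v
      = (\<Prod>u\<in>nonsink (wheel n). if u \<in> arc n p m then var u else 1)"
    unfolding avalanche_monomial_def toppling_vector_fires[OF assms(1,3)] by (intro prod.cong) auto
  also have "\<dots> = (\<Prod>u\<in>arc n p m. var u)"
    using arc_nonsink finite_nonsink by (simp add: prod.inter_restrict[symmetric] Int_absorb1)
  also have "\<dots> = (\<Prod>j\<in>{p..<p + m}. var (rim n j))"
    unfolding arc_def
    by (intro prod.reindex_cong[OF _ refl refl] inj_onI) (use rim_eq_iff[of p] assms(2) in auto)
  also have "\<dots> = arc_monomial p m"
    unfolding arc_monomial_def
    by (rule prod.reindex_bij_witness[of _ "\<lambda>k. p + k" "\<lambda>j. j - p"]) auto
  finally show ?thesis .
qed

lemma arc_monomial_full: "arc_monomial p n = wheel_w n n"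
proof -
  have "arc_monomial p n = (\<Prod>j\<in>{p..<p + n}. var (rim n j))"
    unfolding arc_monomial_def
    by (rule prod.reindex_bij_witness[of _ "\<lambda>j. j - p" "\<lambda>k. p + k"]) auto
  also have "\<dots> = (\<Prod>u\<in>arc n p n. var u)"
    unfolding arc_def
    by (intro prod.reindex_cong[symmetric, OF _ refl refl] inj_onI) (use rim_eq_iff[of p] in auto)
  also have "\<dots> = (\<Prod>i<n. var (Rim i))"
    unfolding arc_full nonsink_wheel by (subst prod.reindex) (auto intro: inj_onI)
  finally show ?thesis by (simp add: wheel_w_def)
qed

lemma arc_monomial_mod: "arc_monomial (p mod n) m = arc_monomial p m"
  by (simp add: arc_monomial_def rim_def mod_add_left_eq)

text \<open>The offset \<open>q\<close> merely permutes the starting points. It is needed because an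
  avalanche need not start its arc at the dropped grain.\<close>

lemma sum_arc_monomial:
  assumes "m < n"
  shows "(\<Sum>i<n. arc_monomial (i + q) m) = wheel_w n m"
proof -
  have "(\<Sum>i<n. arc_monomial (i + q) m) = (\<Sum>i<n. arc_monomial ((i + q) mod n) m)"
    by (simp add: arc_monomial_mod)
  also have "\<dots> = (\<Sum>i<n. arc_monomial i m)"
  proof (rule sum.reindex_bij_betw)
    have inj: "inj_on (\<lambda>i. (i + q) mod n) {..<n}"
    proof (rule inj_onI)
      fix i j assume ij: "i \<in> {..<n}" "j \<in> {..<n}" "(i + q) mod n = (j + q) mod n"
      then have "rim n (i + q) = rim n (j + q)" by (simp add: rim_def)
      then show "i = j" using rim_eq_iff[of q "i + q" "j + q"] ij by simp
    qed
    moreover have "(\<lambda>i. (i + q) mod n) ` {..<n} = {..<n}"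
      using n_ge by (intro endo_inj_surj[OF _ _ inj]) auto
    ultimately show "bij_betw (\<lambda>i. (i + q) mod n) {..<n} {..<n}" by (simp add: bij_betw_def)
  qed
  also have "\<dots> = wheel_w n m"
    using assms by (simp add: wheel_w_def arc_monomial_def rim_def)
  finally show ?thesis .
qed

text \<open>Legal order: the drop vertex, the twos after it from left to right, then the trailing
  twos from right to left. The ends of \<open>u\<close> decide what follows. Two distinct ends,
  holding at most one grain, gain one each and stay stable; a single vertex gains two, so it stays
  stable on 0 and topples on 1.\<close>

lemma avalanche_monomial_word:
  assumes c: "sandpile (wheel n) c" "\<And>v. c v \<le> 2"
    and w: "word n c i = replicate a 2 @ u @ replicate b 2" "1 \<le> a"
  shows "u \<noteq> [] \<Longrightarrow> u \<noteq> [1] \<Longrightarrow> hd u \<noteq> 2 \<Longrightarrow> last u \<noteq> 2 \<Longrightarrow>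
      avalanche_monomial (wheel n) c (rim n i) = arc_monomial (i + n - b) (a + b)"
    and "u = [] \<or> u = [1] \<Longrightarrow> avalanche_monomial (wheel n) c (rim n i) = wheel_w n n"
proof -
  let ?g = "add_grain c (rim n i)"
  \<comment> \<open>The left end of the run, \<open>b\<close> steps before \<open>i\<close>; the
    extra turn \<open>n\<close> avoids truncation.\<close>
  define p where "p = i + n - b"
  have len: "a + length u + b = n"
    using arg_cong[OF w(1), of length] by simp
  have sg: "sandpile (wheel n) ?g" using c(1) by (auto simp: sandpile_def add_grain_def)
  have "0 < n" using n_ge by simp
  have "word n c i ! 0 = 2" using w by (simp add: nth_append)
  then have "?g (rim n i) = 3" using add_grain_rim[of 0 c i] n_ge by simp
  then have "fires (wheel n) ?g (insert (rim n i) {})"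
    by (intro fires_insert fires_empty sg) auto
  then have start: "fires (wheel n) ?g (arc n (i + n) 1)"
    by (simp add: arc_def rim_add_period)
  have right: "2 \<le> ?g (rim n (i + n + t))" if "t < a" for t
  proof -
    have "rim n (i + n + t) = rim n (i + t)"
      using rim_add_period[of n "i + t"] by (simp add: ac_simps)
    moreover have "word n c i ! t = 2" using w that by (simp add: nth_append)
    ultimately show ?thesis using add_grain_rim[of t c i] that len by simp
  qed
  have "fires (wheel n) ?g (arc n (i + n) a)"
    by (rule fires_arc_right[OF start w(2) _ right]) (use len in auto)
  then have start': "fires (wheel n) ?g (arc n (p + b) a)"
    using len by (simp add: p_def)
  have left: "2 \<le> ?g (rim n (p + t))" if "t < b" for t
  proof -
    have "p + t = i + (n - b + t)" using that len by (simp add: p_def)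
    moreover have "word n c i ! (n - b + t) = 2"
    proof -
      have "n - b + t = a + (length u + t)" using len by linarith
      then show ?thesis unfolding w(1) using that by (simp add: nth_append)
    qed
    ultimately show ?thesis using add_grain_rim[of "n - b + t" c i] that len by simp
  qed
  have fires: "fires (wheel n) ?g (arc n p (a + b))"
    by (rule fires_arc_left[OF start' w(2) _ left]) (use len in auto)
  have le3: "?g v \<le> 3" for v using c(2)[of v] by (auto simp: add_grain_def)
  have p1: "1 \<le> p" using len w(2) by (simp add: p_def)
  have out: "?g (rim n (p + (a + b) + t)) = u ! t" if "t < length u" for t
  proof -
    have "p + (a + b) + t = (i + (a + t)) + n" using len by (simp add: p_def)
    then have "rim n (p + (a + b) + t) = rim n (i + (a + t))" by (simp only: rim_add_period)
    moreover have "word n c i ! (a + t) = u ! t" unfolding w(1) using that by (simp add: nth_append)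
    ultimately show ?thesis using add_grain_rim[of "a + t" c i] that len w(2) by simp
  qed
  have letter: "u ! t \<le> 2" if "t < length u" for t
  proof -
    have "u ! t = word n c i ! (a + t)" unfolding w(1) using that by (simp add: nth_append)
    also have "\<dots> = c (rim n (i + (a + t)))" using that len by (intro nth_word) simp
    finally show ?thesis using c(2) by simp
  qed
  show "avalanche_monomial (wheel n) c (rim n i) = arc_monomial (i + n - b) (a + b)"
    if u: "u \<noteq> []" "u \<noteq> [1]" "hd u \<noteq> 2" "last u \<noteq> 2"
    unfolding p_def[symmetric]
  proof (rule avalanche_monomial_fires[OF fires])
    show "a + b \<le> n" using len by simp
    show "stable (wheel n) (fired (wheel n) ?g (arc n p (a + b)))"
    proof (rule stable_fired_arc[OF le3])
      fix j assume j: "p + (a + b) \<le> j" "j < p + n"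
      then obtain t where t: "j = p + (a + b) + t" by (metis le_Suc_ex)
      then have tl: "t < length u" using j len by simp
      have first: "u ! 0 \<noteq> 2" using u by (simp add: hd_conv_nth)
      have final: "u ! (length u - 1) \<noteq> 2" using u by (simp add: last_conv_nth)
      have "u ! 0 \<noteq> 1" if "length u = 1" using that u(2) by (cases u) auto
      then have single: "u ! 0 = 0" if "length u = 1" using that first letter[of 0] by simp
      have "u ! t + of_bool (t = 0) + of_bool (t = length u - 1) \<le> 2"
      proof (cases "length u = 1")
        case True
        then show ?thesis using tl single by simp
      next
        case False
        then have "\<not> (t = 0 \<and> t = length u - 1)" using tl by linarith
        moreover have "u ! t \<le> 1" if "t = 0 \<or> t = length u - 1"
          using that first final letter[OF tl] by auto
        ultimately show ?thesis using letter[OF tl] by (auto simp: of_bool_def)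
      qed
      moreover have "j = p + (a + b) \<longleftrightarrow> t = 0" using t by simp
      moreover have "j = p + n - 1 \<longleftrightarrow> t = length u - 1" using t tl len by auto
      ultimately show "?g (rim n j) + of_bool (j = p + (a + b)) + of_bool (j = p + n - 1) \<le> 2"
        using out[OF tl] t by simp
    qed (use w(2) len p1 in auto)
  qed
  show "avalanche_monomial (wheel n) c (rim n i) = wheel_w n n" if u: "u = [] \<or> u = [1]"
  proof -
    have "fires (wheel n) ?g (arc n p n)"
    proof (cases "u = []")
      case True
      then show ?thesis using fires len by simp
    next
      case False
      then have u1: "u = [1]" using u by simp
      then have ab: "Suc (a + b) = n" using len by simp
      have "p + (a + b) = Suc (p + (n - 2))" using ab n_ge by linarith
      then have eq: "rim n (p + (a + b)) = rim n (Suc (p + (n - 2)))" "p + (n - 2) + 2 = p + n"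
        using n_ge by simp_all
      have "fires (wheel n) ?g (insert (rim n (p + (a + b))) (arc n p (a + b)))"
      proof (rule fires_insert[OF fires])
        show "rim n (p + (a + b)) \<notin> arc n p (a + b)" using ab by (simp add: rim_in_arc)
        have "rim n (p + (n - 2)) \<in> arc n p (a + b)" "rim n (p + n) \<in> arc n p (a + b)"
          using ab w(2) by (simp_all add: rim_in_arc rim_add_period)
        then have "(\<Sum>v\<in>arc n p (a + b). wt (wheel n) v (rim n (p + (a + b)))) = 2"
          unfolding eq(1) sum_wt_arc eq(2) by simp
        then show "deg (wheel n) (rim n (p + (a + b))) \<le> ?g (rim n (p + (a + b)))
            + (\<Sum>v\<in>arc n p (a + b). wt (wheel n) v (rim n (p + (a + b))))"
          using out[of 0] u1 by simp
      qed simp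
      then show ?thesis unfolding arc_Suc_right[symmetric] ab .
    qed
    moreover have "stable (wheel n) (fired (wheel n) ?g (arc n p n))"
      using n_ge p1 by (intro stable_fired_arc le3) auto
    ultimately show ?thesis
      using avalanche_monomial_fires[of c "rim n i" p n] arc_monomial_full by simp
  qed
qed

lemma avalanche_monomial_stable:
  assumes c: "sandpile (wheel n) c" "\<And>v. c v \<le> 2" and hd: "hd (word n c i) \<noteq> 2"
  shows "avalanche_monomial (wheel n) c (rim n i) = 1"
proof -
  let ?g = "add_grain c (rim n i)"
  have sg: "sandpile (wheel n) ?g" using c(1) by (auto simp: sandpile_def add_grain_def)
  have "word n c i \<noteq> []" using n_ge by (simp add: word_def)
  then have "c (rim n i) \<noteq> 2" using hd nth_word[of 0 n c i] n_ge by (simp add: hd_conv_nth)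
  then have le: "?g v < 3" for v using c(2)[of v] by (auto simp: add_grain_def)
  have "stable (wheel n) ?g"
    unfolding stable_def unstable_def
  proof (intro allI notI, elim conjE)
    fix v assume v: "v \<in> nonsink (wheel n)" "deg (wheel n) v \<le> ?g v"
    then obtain k where k: "v = rim n k" using nonsink_obtain by metis
    with le[of v] v(2) show False by simp
  qed
  then have "toppling_vector (wheel n) ?g = count_list []"
    by (intro toppling_vector_eq[OF toppling_seq.Nil])
  then show ?thesis by (simp add: avalanche_monomial_def)
qed

end

section \<open>Counting words\<close>

lemma path_letter:
  "path p (0 # w) q \<longleftrightarrow> p \<and> path False w q"
  "path p (1 # w) q \<longleftrightarrow> path p w q"
  "path p (2 # w) q \<longleftrightarrow> path True w q"
  by (cases p; auto)+

lemma path_letters: "path p w q \<Longrightarrow> set w \<subseteq> {..2}"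
  by (induction w arbitrary: p) auto

lemma path_functional: "path p w q \<Longrightarrow> path p w q' \<Longrightarrow> q = q'"
proof (induction w arbitrary: p)
  case (Cons x w)
  then obtain r r' where "step p x r" "path r w q" "step p x r'" "path r' w q'" by auto
  moreover from this have "r = r'" by auto
  ultimately show ?case using Cons.IH by blast
qed simp

lemma path_append: "path p (v @ w) q \<longleftrightarrow> (\<exists>r. path p v r \<and> path r w q)"
  by (induction v arbitrary: p) (simp, simp only: append_Cons path.simps, blast)

lemma path_replicate_2: "path p (replicate a 2) q \<longleftrightarrow> (if a = 0 then p = q else q)"
  by (induction a arbitrary: p) (simp, simp only: replicate_Suc path_letter, simp)

lemma card_words_Suc:
  fixes R :: "nat list \<Rightarrow> bool"
  assumes "\<And>w. R w \<Longrightarrow> set w \<subseteq> {..2}"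
  shows "card {w. length w = Suc k \<and> R w} = card {w. length w = k \<and> R (0 # w)}
    + card {w. length w = k \<and> R (1 # w)} + card {w. length w = k \<and> R (2 # w)}"
proof -
  let ?A = "\<lambda>x. {w. length w = k \<and> R (x # w)}"
  have fin: "finite (?A x)" for x
  proof (rule finite_subset)
    show "?A x \<subseteq> {w. set w \<subseteq> {..2} \<and> length w = k}" using assms[of "x # w" for w] by auto
  qed (simp add: finite_lists_length_eq)
  have "{w. length w = Suc k \<and> R w} = (\<Union>x\<in>{..2}. (#) x ` ?A x)"
    using assms by (fastforce simp: length_Suc_conv)
  also have "card \<dots> = (\<Sum>x\<le>2. card ((#) x ` ?A x))"
    using fin by (intro card_UN_disjoint) auto
  also have "\<dots> = (\<Sum>x\<le>2. card (?A x))"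
    by (simp add: card_image)
  also have "\<dots> = card (?A 0) + card (?A 1) + card (?A 2)"
    by (simp add: numeral_2_eq_2)
  finally show ?thesis .
qed

lemmas card_path_Suc = card_words_Suc[of "\<lambda>w. path p w q" for p q, OF path_letters]

text \<open>Splitting off the first letter turns the counts (x, y) into (2x + y, x + y), two steps
  of the Fibonacci recursion. The two starting states must be treated together because the recursion
  mixes them.\<close>

lemma card_path_to_True:
  "card {w. length w = k \<and> path True w True} = fib (2 * k + 1) \<and>
   card {w. length w = k \<and> path False w True} = fib (2 * k)"
proof (induction k)
  case 0
  have "{w. length w = 0 \<and> path True w True} = {[]}" "{w. length w = 0 \<and> path False w True} = {}"
    by auto
  then show ?case by simp
next
  case (Suc k)
  then show ?case by (simp add: card_path_Suc path_letter del: path.simps One_nat_def) simp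
qed

text \<open>The second count is the Fibonacci number of index \<open>2k - 1\<close>. At
  \<open>k = 0\<close> it must be 1, while truncated subtraction would give
  \<open>fib 0 = 0\<close>; hence the additive form.\<close>

lemma card_path_to_False:
  "card {w. length w = k \<and> path True w False} = fib (2 * k) \<and>
   card {w. length w = k \<and> path False w False} + fib (2 * k) = fib (2 * k + 1)"
proof (induction k)
  case 0
  have "{w. length w = 0 \<and> path True w False} = {}" "{w. length w = 0 \<and> path False w False} = {[]}"
    by auto
  then show ?case by simp
next
  case (Suc k)
  then show ?case by (simp add: card_path_Suc path_letter del: path.simps One_nat_def) simp
qed

lemma eq_replicate_iff: "w = replicate k x \<longleftrightarrow> length w = k \<and> (\<forall>y\<in>set w. y = x)"
  by (auto intro: replicate_eqI)

text \<open>After a 2 both starting states merge and cannot separate again, and a 0 cannot be read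
  from \<open>False\<close>. This identifies the overlap when loops at the two states are counted
  together.\<close>

lemma path_loops_iff: "path True w True \<and> path False w False \<longleftrightarrow> (\<forall>x\<in>set w. x = 1)"
proof (induction w)
  case (Cons x w)
  show ?case
  proof (cases "x \<le> 2")
    case True
    then consider "x = 0" | "x = 1" | "x = 2" by linarith
    then show ?thesis
    proof cases
      case 2
      then show ?thesis unfolding 2 path_letter Cons.IH by simp
    next
      case 3
      then show ?thesis unfolding 3 path_letter using path_functional[of True w True False] by auto
    qed simp
  qed simp
qed simp

text \<open>With \<open>k = n - 1\<close>, a leading 0 requires a remainder from
  \<open>False\<close> to \<open>True\<close>, and a leading 1 a remainder looping at either state.
  The counts \<open>fib (2 * k)\<close>, \<open>fib (2 * k + 1)\<close> and
  \<open>fib (2 * k + 1) - fib (2 * k)\<close> add up to \<open>2 * fib (2 * k + 1)\<close>, less a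
  correction of 2.\<close>

lemma card_good_hd:
  assumes "1 \<le> n"
  shows "card {w. length w = n \<and> good w \<and> hd w \<noteq> 2} = 2 * (fib (2 * n - 1) - 1)"
proof -
  obtain k where n: "n = Suc k" using assms by (cases n) auto
  let ?T = "{w. length w = k \<and> path True w True}" and ?F = "{w. length w = k \<and> path False w False}"
  let ?one = "replicate k (1::nat)"
  have fin: "finite {w. length w = k \<and> path p w q}" for p q
    by (rule finite_subset[of _ "{w. set w \<subseteq> {..2} \<and> length w = k}"])
      (use path_letters in \<open>auto simp: finite_lists_length_eq\<close>)
  have "set w \<subseteq> {..2}" if "good w \<and> hd w \<noteq> 2" for w
    using that path_letters by (auto simp: good_def)
  then have "card {w. length w = n \<and> good w \<and> hd w \<noteq> 2}
      = card {w. length w = k \<and> good (0 # w) \<and> hd (0 # w) \<noteq> 2}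
      + card {w. length w = k \<and> good (1 # w) \<and> hd (1 # w) \<noteq> 2}
      + card {w. length w = k \<and> good (2 # w) \<and> hd (2 # w) \<noteq> 2}"
    unfolding n by (rule card_words_Suc)
  also have "{w. length w = k \<and> good (0 # w) \<and> hd (0 # w) \<noteq> 2} = {w. length w = k \<and> path False w True}"
    unfolding good_def path_letter by auto
  also have "{w. length w = k \<and> good (1 # w) \<and> hd (1 # w) \<noteq> 2} = ?T \<union> ?F - {?one}"
  proof -
    have "{w. length w = k \<and> good (1 # w) \<and> hd (1 # w) \<noteq> 2}
      = ?T \<union> ?F - {w. length w = k \<and> (\<forall>x\<in>set w. x = 1)}"
      unfolding good_def path_letter ex_bool_eq by auto
    also have "{w. length w = k \<and> (\<forall>x\<in>set w. x = 1)} = {?one}"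
      unfolding eq_replicate_iff[symmetric] by simp
    finally show ?thesis .
  qed
  also have "{w. length w = k \<and> good (2 # w) \<and> hd (2 # w) \<noteq> 2} = {}" by simp
  finally have "card {w. length w = n \<and> good w \<and> hd w \<noteq> 2}
      = fib (2 * k) + card (?T \<union> ?F - {?one})"
    using card_path_to_True by simp
  \<comment> \<open>The all-ones word is subtracted twice: once as the overlap, once because
    \<open>good\<close> rejects it.\<close>
  moreover have "card (?T \<union> ?F - {?one}) + 2 = card ?T + card ?F"
  proof -
    have "?T \<inter> ?F = {w. length w = k \<and> (\<forall>x\<in>set w. x = 1)}" using path_loops_iff by blast
    also have "\<dots> = {?one}" unfolding eq_replicate_iff[symmetric] by simp
    finally have int: "?T \<inter> ?F = {?one}" .
    then have sub: "{?one} \<subseteq> ?T \<union> ?F" by blast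
    have "card (?T \<union> ?F) + 1 = card ?T + card ?F"
      using card_Un_Int[OF fin fin, of True True False False] int by simp
    moreover have "card (?T \<union> ?F) = card (?T \<union> ?F - {?one}) + 1"
      using card_Diff_subset[OF _ sub] card_mono[OF _ sub] fin by simp
    ultimately show ?thesis by simp
  qed
  moreover have "fib (2 * n - 1) = fib (2 * k + 1)" using n by simp
  ultimately show ?thesis
    using conjunct1[OF card_path_to_True[of k]] conjunct2[OF card_path_to_False[of k]] by linarith
qed

section \<open>Blocks between the leading and the trailing twos\<close>

definition runs :: "nat \<Rightarrow> nat list set" where
  "runs L = {u. length u = L \<and> (\<exists>q. path True u q) \<and> hd u \<noteq> 2 \<and> last u \<noteq> 2}"

text \<open>The same recursion as for walks with a fixed end, started at length 1 because
  \<open>last []\<close> is unspecified.\<close>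

lemma card_path_last:
  "card {w. length w = Suc k \<and> (\<exists>q. path True w q) \<and> last w \<noteq> 2} = fib (2 * k + 3) \<and>
   card {w. length w = Suc k \<and> (\<exists>q. path False w q) \<and> last w \<noteq> 2} = fib (2 * k + 2)"
proof (induction k)
  case 0
  have "{w. length w = Suc 0 \<and> (\<exists>q. path True w q) \<and> last w \<noteq> 2} = {[0], [1]}"
    "{w. length w = Suc 0 \<and> (\<exists>q. path False w q) \<and> last w \<noteq> 2} = {[1]}"
    by (auto simp: length_Suc_conv ex_bool_eq)
  then show ?case by (simp add: numeral_eq_Suc)
next
  case (Suc k)
  have "card {w. length w = Suc (Suc k) \<and> (\<exists>q. path p w q) \<and> last w \<noteq> 2}
     = card {w. length w = Suc k \<and> (\<exists>q. path p (0 # w) q) \<and> last (0 # w) \<noteq> 2}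
     + card {w. length w = Suc k \<and> (\<exists>q. path p (1 # w) q) \<and> last (1 # w) \<noteq> 2}
     + card {w. length w = Suc k \<and> (\<exists>q. path p (2 # w) q) \<and> last (2 # w) \<noteq> 2}" for p
    by (rule card_words_Suc) (use path_letters in blast)
  moreover have "{w. length w = Suc k \<and> Q w \<and> last (x # w) \<noteq> 2}
      = {w. length w = Suc k \<and> Q w \<and> last w \<noteq> 2}" for x and Q :: "nat list \<Rightarrow> bool"
    by auto
  ultimately have "card {w. length w = Suc (Suc k) \<and> (\<exists>q. path p w q) \<and> last w \<noteq> 2}
     = card {w. length w = Suc k \<and> (\<exists>q. path p (0 # w) q) \<and> last w \<noteq> 2}
     + card {w. length w = Suc k \<and> (\<exists>q. path p (1 # w) q) \<and> last w \<noteq> 2}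
     + card {w. length w = Suc k \<and> (\<exists>q. path p (2 # w) q) \<and> last w \<noteq> 2}" for p
    by (simp only:)
  moreover have "fib (2 * Suc k + 3) = 2 * fib (2 * k + 3) + fib (2 * k + 2)"
    "fib (2 * Suc k + 2) = fib (2 * k + 3) + fib (2 * k + 2)"
    by (simp_all add: numeral_eq_Suc)
  ultimately show ?case using Suc.IH
    by (simp add: path_letter del: path.simps One_nat_def)
qed

lemma card_runs: "card (runs (Suc (Suc k))) = fib (2 * Suc (Suc k))"
proof -
  let ?R = "\<lambda>w. (\<exists>q. path True w q) \<and> hd w \<noteq> 2 \<and> last w \<noteq> 2"
  have "card (runs (Suc (Suc k))) = card {w. length w = Suc k \<and> ?R (0 # w)}
     + card {w. length w = Suc k \<and> ?R (1 # w)} + card {w. length w = Suc k \<and> ?R (2 # w)}"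
    unfolding runs_def by (rule card_words_Suc) (use path_letters in blast)
  also have "{w. length w = Suc k \<and> ?R (0 # w)}
      = {w. length w = Suc k \<and> (\<exists>q. path False w q) \<and> last w \<noteq> 2}"
    unfolding path_letter by auto
  also have "{w. length w = Suc k \<and> ?R (1 # w)}
      = {w. length w = Suc k \<and> (\<exists>q. path True w q) \<and> last w \<noteq> 2}"
    unfolding path_letter by auto
  also have "{w. length w = Suc k \<and> ?R (2 # w)} = {}" by simp
  finally show ?thesis using card_path_last[of k] by (simp add: numeral_eq_Suc)
qed

lemma runs_1: "runs 1 = {[0], [1]}"
  by (auto simp: runs_def length_Suc_conv ex_bool_eq)

text \<open>\<open>m\<close> is the size of the cyclic run of twos and \<open>a\<close> the number
  of them from the dropped grain onwards, so \<open>a\<close> in \<open>{1..m}\<close> lists the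
  places of the grain within the run.\<close>

definition insert_run :: "nat \<times> nat \<times> nat list \<Rightarrow> nat list" where
  "insert_run = (\<lambda>(m, a, u). replicate a 2 @ u @ replicate (m - a) 2)"

text \<open>A leading 2 makes the starting state irrelevant. Without trailing twos the start can be
  chosen equal to the final state \<open>q\<close>; with trailing twos the walk ends in
  \<open>True\<close> and closes from there.\<close>

lemma good_insert_run:
  assumes "1 \<le> a"
  shows "good (insert_run (m, a, u)) \<longleftrightarrow> (\<exists>q. path True u q)"
proof -
  have "(\<exists>p. path p (insert_run (m, a, u)) p) \<longleftrightarrow> (\<exists>q. path True u q)"
    using assms unfolding insert_run_def prod.case path_append path_replicate_2
    by (cases "m - a = 0") auto
  moreover have "2 \<in> set (insert_run (m, a, u))" using assms by (auto simp: insert_run_def)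
  then have "\<exists>x\<in>set (insert_run (m, a, u)). x \<noteq> 1" by (rule bexI[rotated]) simp
  ultimately show ?thesis unfolding good_def by simp
qed

text \<open>\<open>a\<close> and \<open>m - a\<close> are recovered as the lengths of the leading
  run of twos in the word and in its reverse. Conversely, cut at the first and the last letter other
  than 2; the all-two word has none and is treated separately.\<close>

lemma bij_insert_run:
  "bij_betw insert_run (SIGMA m:{1..n-1}. SIGMA a:{1..m}. runs (n - m))
     {w. length w = n \<and> good w \<and> hd w = 2 \<and> w \<noteq> replicate n 2}"
  (is "bij_betw _ ?S ?W")
proof (rule bij_betw_imageI)
  have take: "takeWhile (\<lambda>x. x = 2) (replicate a (2::nat) @ u @ v) = replicate a 2"
    if "u \<noteq> []" "hd u \<noteq> 2" for a u v
    using that by (cases u) (simp_all add: takeWhile_append takeWhile_replicate)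
  show "inj_on insert_run ?S"
  proof (rule inj_onI)
    fix s s' assume ss: "s \<in> ?S" "s' \<in> ?S" "insert_run s = insert_run s'"
    obtain m a u m' a' u' where s: "s = (m, a, u)" "s' = (m', a', u')"
      by (cases s; cases s') auto
    have in1: "m \<in> {1..n-1}" "a \<in> {1..m}" "u \<in> runs (n - m)"
      and in2: "m' \<in> {1..n-1}" "a' \<in> {1..m'}" "u' \<in> runs (n - m')"
      and eq: "insert_run (m, a, u) = insert_run (m', a', u')"
      using ss s by auto
    have u: "u \<noteq> []" "hd u \<noteq> 2" "hd (rev u) \<noteq> 2" "u' \<noteq> []" "hd u' \<noteq> 2" "hd (rev u') \<noteq> 2"
      using in1 in2 by (auto simp: runs_def hd_rev)
    have aa: "a = a'"
      using arg_cong[OF eq, of "\<lambda>w. length (takeWhile (\<lambda>x. x = 2) w)"] u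
      by (simp add: insert_run_def take)
    have "m - a = m' - a'"
      using arg_cong[OF eq, of "\<lambda>w. length (takeWhile (\<lambda>x. x = 2) (rev w))"] u
      by (simp add: insert_run_def take)
    moreover have "a \<le> m" "a' \<le> m'" using in1 in2 by auto
    ultimately have "m = m'" using aa by linarith
    with aa eq s show "s = s'" by (simp add: insert_run_def)
  qed
  show "insert_run ` ?S = ?W"
  proof (intro equalityI subsetI)
    fix w assume "w \<in> insert_run ` ?S"
    then obtain m a u where mau: "m \<in> {1..n-1}" "a \<in> {1..m}" "u \<in> runs (n - m)"
      "w = insert_run (m, a, u)" by auto
    then have u: "u \<noteq> []" "hd u \<noteq> 2" "length u = n - m" "\<exists>q. path True u q"
      by (auto simp: runs_def)
    have "length w = n" using mau u by (auto simp: insert_run_def)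
    moreover have "good w" using mau u good_insert_run by auto
    moreover have "hd w = 2" using mau by (cases a) (auto simp: insert_run_def)
    moreover have "hd u \<in> set w" using u mau by (auto simp: insert_run_def)
    then have "w \<noteq> replicate n 2" using u(2) by (metis in_set_replicate)
    ultimately show "w \<in> ?W" by blast
  next
    fix w assume "w \<in> ?W"
    then have w: "length w = n" "good w" "hd w = 2" "w \<noteq> replicate n 2" by auto
    have "\<exists>x\<in>set w. x \<noteq> 2" using w(1,4) unfolding eq_replicate_iff by blast
    then obtain ys x zs where 1: "w = ys @ x # zs" "x \<noteq> 2" "\<forall>y\<in>set ys. y = 2"
      using split_list_first_prop[of w "\<lambda>x. x \<noteq> 2"] by auto
    have "\<exists>x\<in>set (x # zs). x \<noteq> 2" using 1 by simp
    then obtain us y vs where 2: "x # zs = us @ y # vs" "y \<noteq> 2" "\<forall>y\<in>set vs. y = 2"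
      using split_list_last_prop[of "x # zs" "\<lambda>x. x \<noteq> 2"] by blast
    define a b u where "a = length ys" and "b = length vs" and "u = us @ [y]"
    have ys: "ys = replicate a 2" and vs: "vs = replicate b 2"
      using 1(3) 2(3) by (simp_all add: eq_replicate_iff a_def b_def)
    have "w = replicate a 2 @ us @ y # replicate b 2"
      unfolding 1(1) 2(1) ys[symmetric] vs[symmetric] by (rule refl)
    also have "\<dots> = insert_run (a + b, a, u)" by (simp add: insert_run_def u_def)
    finally have wu: "w = insert_run (a + b, a, u)" .
    have "ys \<noteq> []" using 1(1,2) w(3) by auto
    then have a: "1 \<le> a" by (simp add: a_def Suc_le_eq)
    have hdu: "hd u = x" using arg_cong[OF 2(1), of hd] by (cases us) (auto simp: u_def)
    have "length (insert_run (a + b, a, u)) = a + b + length u" by (simp add: insert_run_def)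
    then have len: "n = a + b + length u" using w(1) wu by simp
    have "\<exists>q. path True u q" using good_insert_run[OF a] w(2) wu by blast
    then have "u \<in> runs (n - (a + b))"
      using hdu 1(2) 2(2) len by (auto simp: runs_def u_def)
    moreover have "a + b \<in> {1..n-1}" "a \<in> {1..a+b}" using a len by (auto simp: u_def)
    ultimately have "(a + b, a, u) \<in> ?S" by blast
    with wu show "w \<in> insert_run ` ?S" by blast
  qed
qed

section \<open>The avalanche polynomial\<close>

text \<open>Inverse of reading the word from \<open>i\<close>; \<open>(n - 1) * i\<close> is again
  \<open>- i\<close> modulo \<open>n\<close>.\<close>

definition sandpile_of_word :: "nat \<Rightarrow> nat \<Rightarrow> nat list \<Rightarrow> wheel_vertex \<Rightarrow> nat" where
  "sandpile_of_word n i w v = (case v of Hub \<Rightarrow> 0 | Rim j \<Rightarrow> if j < n then w ! ((j + (n - 1) * i) mod n) else 0)"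

context wheel_graph
begin

lemma mod_shift: "(k + i + (n - 1) * i) mod n = k mod n"
proof -
  have "k + i + (n - 1) * i = k + n * i" using n_ge by (cases n) auto
  then show ?thesis by (simp only: mod_mult_self2)
qed

lemma sandpile_sandpile_of_word: "sandpile (wheel n) (sandpile_of_word n i w)"
  by (auto simp: sandpile_def nonsink_wheel sandpile_of_word_def split: wheel_vertex.split)

lemma sandpile_of_word_rim: "sandpile_of_word n i w (rim n (i + k)) = w ! (k mod n)"
  using n_ge mod_shift[of k i] mod_add_left_eq[of "i + k" n "(n - 1) * i"]
  by (simp add: sandpile_of_word_def rim_def add.commute add.left_commute)

lemma word_sandpile_of_word: "length w = n \<Longrightarrow> word n (sandpile_of_word n i w) i = w"
  by (rule nth_equalityI) (simp_all add: nth_word sandpile_of_word_rim)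

lemma sandpile_of_word_word:
  assumes "sandpile (wheel n) c"
  shows "sandpile_of_word n i (word n c i) = c"
proof
  fix v
  show "sandpile_of_word n i (word n c i) v = c v"
  proof (cases "v \<in> nonsink (wheel n)")
    case True
    obtain l where l: "l \<ge> i" "v = rim n l" using nonsink_obtain[OF True] by metis
    then obtain k where k: "v = rim n (i + k)" by (metis le_Suc_ex)
    have "rim n (i + k mod n) = rim n (i + k)" by (simp add: rim_def mod_add_right_eq)
    then show ?thesis using n_ge k by (simp add: sandpile_of_word_rim nth_word)
  next
    case False
    then show ?thesis using assms sandpile_sandpile_of_word by (simp add: sandpile_def)
  qed
qed

lemma recurrent_sandpile_of_word:
  "length w = n \<Longrightarrow> recurrent (wheel n) (sandpile_of_word n i w) \<longleftrightarrow> good w"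
  using recurrent_iff_good[OF sandpile_sandpile_of_word, of i w i] by (simp add: word_sandpile_of_word)

lemma recurrent_le_2:
  assumes "recurrent (wheel n) c"
  shows "c v \<le> 2"
proof (cases "v \<in> nonsink (wheel n)")
  case True
  then obtain k where "v = rim n k" using nonsink_obtain by metis
  then have "deg (wheel n) v = 3" by simp
  moreover have "\<not> unstable (wheel n) c v" using assms by (simp add: recurrent_iff stable_def)
  ultimately show ?thesis using True by (simp add: unstable_def)
next
  case False
  then show ?thesis using assms by (simp add: recurrent_iff sandpile_def)
qed

lemma finite_good: "finite {w. length w = n \<and> good w}"
proof (rule finite_subset)
  show "{w. length w = n \<and> good w} \<subseteq> {w. set w \<subseteq> {..2} \<and> length w = n}"
    using path_letters by (auto simp: good_def)
qed (simp add: finite_lists_length_eq)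

text \<open>For \<open>L = 1\<close> there are two blocks but \<open>fib 2 = 1\<close>:
  \<open>[0]\<close> fits the general formula, and the surplus block \<open>[1]\<close> is the one
  that makes every vertex topple.\<close>

lemma sum_runs:
  fixes x y :: "'a :: comm_ring_1"
  assumes "1 \<le> L"
  shows "(\<Sum>u\<in>runs L. if u = [1] then x else y) = of_nat (fib (2 * L)) * y + (if L = 1 then x else 0)"
proof (cases "L = 1")
  case True
  then show ?thesis by (simp add: runs_1[unfolded One_nat_def] numeral_2_eq_2)
next
  case False
  with assms obtain k where k: "L = Suc (Suc k)" by (metis One_nat_def Suc_le_D le_SucE not0_implies_Suc)
  have "(\<Sum>u\<in>runs L. if u = [1] then x else y) = (\<Sum>u\<in>runs L. y)"
    by (intro sum.cong) (auto simp: runs_def k)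
  then show ?thesis using card_runs[of k] k by simp
qed

lemma sum_avalanches_at:
  "(\<Sum>c | recurrent (wheel n) c. avalanche_monomial (wheel n) c (rim n i)) =
     of_nat (2 * (fib (2 * n - 1) - 1)) + of_nat n * wheel_w n n
     + (\<Sum>m=1..n-1. \<Sum>a=1..m. of_nat (fib (2 * (n - m))) * arc_monomial (i + (n - (m - a))) m)"
  (is "_ = ?rhs")
proof -
  let ?mon = "\<lambda>w. avalanche_monomial (wheel n) (sandpile_of_word n i w) (rim n i)"
  let ?W = "{w. length w = n \<and> good w}"
  let ?U = "{w. length w = n \<and> good w \<and> hd w \<noteq> 2}"
  let ?V = "{w. length w = n \<and> good w \<and> hd w = 2 \<and> w \<noteq> replicate n 2}"
  let ?S = "SIGMA m:{1..n-1}. SIGMA a:{1..m}. runs (n - m)"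
  have le2: "sandpile_of_word n i w v \<le> 2" if "w \<in> ?W" for w v
    using that recurrent_sandpile_of_word[of w i] recurrent_le_2 by blast
  have twos: "replicate n 2 \<in> ?W"
    using n_ge by (auto simp: good_def path_replicate_2)
  have fin: "finite ?U" "finite ?V"
    by (rule finite_subset[OF _ finite_good]; blast)+
  have "(\<Sum>c | recurrent (wheel n) c. avalanche_monomial (wheel n) c (rim n i)) = (\<Sum>w\<in>?W. ?mon w)"
  proof (rule sum.reindex_bij_witness[of _ "sandpile_of_word n i" "\<lambda>c. word n c i"])
    fix c assume "c \<in> {c. recurrent (wheel n) c}"
    then have c: "recurrent (wheel n) c" "sandpile (wheel n) c" by (auto simp: recurrent_iff)
    show "sandpile_of_word n i (word n c i) = c" by (rule sandpile_of_word_word[OF c(2)])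
    then show "?mon (word n c i) = avalanche_monomial (wheel n) c (rim n i)" by simp
    show "word n c i \<in> ?W" using c recurrent_iff_good[OF c(2)] by simp
  next
    fix w assume "w \<in> ?W"
    then show "word n (sandpile_of_word n i w) i = w" "sandpile_of_word n i w \<in> {c. recurrent (wheel n) c}"
      by (simp_all add: word_sandpile_of_word recurrent_sandpile_of_word)
  qed
  also have "?W = ?U \<union> insert (replicate n 2) ?V"
    using twos n_ge by auto
  also have "(\<Sum>w\<in>\<dots>. ?mon w) = (\<Sum>w\<in>?U. ?mon w) + (\<Sum>w\<in>insert (replicate n 2) ?V. ?mon w)"
    by (rule sum.union_disjoint) (use fin n_ge in auto)
  also have "(\<Sum>w\<in>?U. ?mon w) = (\<Sum>w\<in>?U. 1)"
  proof (rule sum.cong[OF refl])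
    fix w assume w: "w \<in> ?U"
    then have "w \<in> ?W" "hd (word n (sandpile_of_word n i w) i) \<noteq> 2" by (simp_all add: word_sandpile_of_word)
    then show "?mon w = 1" by (rule avalanche_monomial_stable[OF sandpile_sandpile_of_word le2])
  qed
  also have "\<dots> = of_nat (2 * (fib (2 * n - 1) - 1))"
    using card_good_hd[of n] n_ge by simp
  also have "(\<Sum>w\<in>insert (replicate n 2) ?V. ?mon w) = ?mon (replicate n 2) + (\<Sum>w\<in>?V. ?mon w)"
    using fin(2) by (rule sum.insert) simp
  also have "?mon (replicate n 2) = wheel_w n n"
  proof (rule avalanche_monomial_word(2)[OF sandpile_sandpile_of_word le2])
    show "word n (sandpile_of_word n i (replicate n 2)) i = replicate n 2 @ [] @ replicate 0 2"
      by (simp add: word_sandpile_of_word)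
  qed (use twos n_ge in auto)
  also have "(\<Sum>w\<in>?V. ?mon w) = (\<Sum>s\<in>?S. ?mon (insert_run s))"
    by (rule sum.reindex_bij_betw[OF bij_insert_run, symmetric])
  also have "\<dots> = (\<Sum>(m, a, u)\<in>?S.
      if u = [1] then wheel_w n n else arc_monomial (i + (n - (m - a))) m)"
  proof (rule sum.cong[OF refl], clarify)
    fix m a u assume mau: "m \<in> {1..n-1}" "a \<in> {1..m}" "u \<in> runs (n - m)"
    then have "(m, a, u) \<in> ?S" by blast
    then have "insert_run (m, a, u) \<in> ?V" by (rule bspec[OF bij_betwE[OF bij_insert_run]])
    then have w: "length (insert_run (m, a, u)) = n" "insert_run (m, a, u) \<in> ?W" by auto
    have eq: "word n (sandpile_of_word n i (insert_run (m, a, u))) i = replicate a 2 @ u @ replicate (m - a) 2"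
      unfolding word_sandpile_of_word[OF w(1)] by (simp add: insert_run_def)
    have a: "1 \<le> a" "a + (m - a) = m" "i + n - (m - a) = i + (n - (m - a))" using mau(1,2) by auto
    have u: "u \<noteq> []" "hd u \<noteq> 2" "last u \<noteq> 2" using mau by (auto simp: runs_def)
    show "?mon (insert_run (m, a, u))
      = (if u = [1] then wheel_w n n else arc_monomial (i + (n - (m - a))) m)"
      using avalanche_monomial_word[OF sandpile_sandpile_of_word le2[OF w(2)] eq a(1)] u a(2,3) by simp
  qed
  also have "\<dots> = (\<Sum>m=1..n-1. \<Sum>a=1..m. \<Sum>u\<in>runs (n - m).
      if u = [1] then wheel_w n n else arc_monomial (i + (n - (m - a))) m)"
  proof -
    have fin: "finite (runs L)" for L
      by (rule finite_subset[of _ "{w. set w \<subseteq> {..2} \<and> length w = L}"])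
        (use path_letters in \<open>auto simp: runs_def finite_lists_length_eq\<close>)
    then show ?thesis by (simp add: sum.Sigma)
  qed
  also have "\<dots> = (\<Sum>m=1..n-1. \<Sum>a=1..m.
      of_nat (fib (2 * (n - m))) * arc_monomial (i + (n - (m - a))) m
      + (if m = n - 1 then wheel_w n n else 0))"
  proof (intro sum.cong refl)
    fix m a assume "m \<in> {1..n-1}"
    then have "1 \<le> n - m" "n - m = 1 \<longleftrightarrow> m = n - 1" by auto
    then show "(\<Sum>u\<in>runs (n - m). if u = [1] then wheel_w n n else arc_monomial (i + (n - (m - a))) m)
      = of_nat (fib (2 * (n - m))) * arc_monomial (i + (n - (m - a))) m
      + (if m = n - 1 then wheel_w n n else 0)"
      by (simp only: sum_runs)
  qed
  also have "\<dots> = (\<Sum>m=1..n-1. \<Sum>a=1..m.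
      of_nat (fib (2 * (n - m))) * arc_monomial (i + (n - (m - a))) m)
      + (\<Sum>m=1..n-1. \<Sum>a=1..m. if m = n - 1 then wheel_w n n else 0)"
    by (simp only: sum.distrib)
  also have "(\<Sum>m=1..n-1. \<Sum>a=1..m. if m = n - 1 then wheel_w n n else 0)
      = (\<Sum>m=1..n-1. if m = n - 1 then of_nat m * wheel_w n n else 0)"
    by (intro sum.cong) auto
  \<comment> \<open>The block \<open>[1]\<close> needs \<open>m = n - 1\<close> and occurs once for
    each \<open>a\<close>. With the all-two word, this makes the coefficient
    \<open>n\<close>.\<close>
  also have "\<dots> = of_nat (n - 1) * wheel_w n n"
  proof -
    have "n - 1 \<in> {1..n-1}" using n_ge by simp
    then show ?thesis by (simp only: sum.delta finite_atLeastAtMost if_True)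
  qed
  finally have "(\<Sum>c | recurrent (wheel n) c. avalanche_monomial (wheel n) c (rim n i))
    = of_nat (2 * (fib (2 * n - 1) - 1)) + (1 + of_nat (n - 1)) * wheel_w n n
     + (\<Sum>m=1..n-1. \<Sum>a=1..m. of_nat (fib (2 * (n - m))) * arc_monomial (i + (n - (m - a))) m)"
    by (simp add: algebra_simps)
  moreover have "1 + of_nat (n - 1) = (of_nat n :: wheel_vertex int_mpoly)"
    using n_ge by (simp flip: of_nat_Suc)
  ultimately show ?thesis by (simp only:)
qed

lemma avalanche_poly_wheel:
  "avalanche_poly (wheel n) = of_nat (n\<^sup>2) * wheel_w n n
     + (\<Sum>m=1..n-1. of_nat (m * fib (2 * (n - m))) * wheel_w n m)
     + of_nat (2 * n) * (of_nat (fib (2 * n - 1)) - 1)"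
proof -
  have "avalanche_poly (wheel n)
      = (\<Sum>v\<in>nonsink (wheel n). \<Sum>c | recurrent (wheel n) c. avalanche_monomial (wheel n) c v)"
    unfolding avalanche_poly_def by (rule sum.swap)
  also have "\<dots> = (\<Sum>i<n. \<Sum>c | recurrent (wheel n) c. avalanche_monomial (wheel n) c (Rim i))"
    unfolding nonsink_wheel by (subst sum.reindex) (auto intro: inj_onI)
  also have "\<dots> = (\<Sum>i<n. of_nat (2 * (fib (2 * n - 1) - 1)) + of_nat n * wheel_w n n
     + (\<Sum>m=1..n-1. \<Sum>a=1..m. of_nat (fib (2 * (n - m))) * arc_monomial (i + (n - (m - a))) m))"
  proof (intro sum.cong refl)
    fix i assume "i \<in> {..<n}"
    then have "Rim i = rim n i" by (simp add: rim_def)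
    then show "(\<Sum>c | recurrent (wheel n) c. avalanche_monomial (wheel n) c (Rim i))
      = of_nat (2 * (fib (2 * n - 1) - 1)) + of_nat n * wheel_w n n
     + (\<Sum>m=1..n-1. \<Sum>a=1..m. of_nat (fib (2 * (n - m))) * arc_monomial (i + (n - (m - a))) m)"
      by (simp only: sum_avalanches_at)
  qed
  also have "\<dots> = of_nat n * of_nat (2 * (fib (2 * n - 1) - 1)) + of_nat n * (of_nat n * wheel_w n n)
     + (\<Sum>i<n. \<Sum>m=1..n-1. \<Sum>a=1..m.
         of_nat (fib (2 * (n - m))) * arc_monomial (i + (n - (m - a))) m)"
    by (simp only: sum.distrib sum_constant card_lessThan)
  also have "(\<Sum>i<n. \<Sum>m=1..n-1. \<Sum>a=1..m.
         of_nat (fib (2 * (n - m))) * arc_monomial (i + (n - (m - a))) m)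
     = (\<Sum>m=1..n-1. \<Sum>i<n. \<Sum>a=1..m.
         of_nat (fib (2 * (n - m))) * arc_monomial (i + (n - (m - a))) m)"
    by (rule sum.swap)
  also have "\<dots> = (\<Sum>m=1..n-1. of_nat (m * fib (2 * (n - m))) * wheel_w n m)"
  proof (rule sum.cong[OF refl])
    fix m assume "m \<in> {1..n-1}"
    then have m: "m < n" by auto
    have "(\<Sum>i<n. \<Sum>a=1..m. of_nat (fib (2 * (n - m))) * arc_monomial (i + (n - (m - a))) m)
      = (\<Sum>a=1..m. \<Sum>i<n. of_nat (fib (2 * (n - m))) * arc_monomial (i + (n - (m - a))) m)"
      by (rule sum.swap)
    \<comment> \<open>Summation over all drop vertices absorbs the offset
      \<open>n - (m - a)\<close>, so the \<open>m\<close> values of \<open>a\<close> contribute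
      equally.\<close>
    also have "\<dots> = (\<Sum>a=1..m. of_nat (fib (2 * (n - m))) * wheel_w n m)"
      by (simp only: sum_distrib_left[symmetric] sum_arc_monomial[OF m])
    also have "\<dots> = of_nat (m * fib (2 * (n - m))) * wheel_w n m"
      by (simp add: mult.assoc)
    finally show "(\<Sum>i<n. \<Sum>a=1..m. of_nat (fib (2 * (n - m))) * arc_monomial (i + (n - (m - a))) m)
      = of_nat (m * fib (2 * (n - m))) * wheel_w n m" .
  qed
  \<comment> \<open>Subtraction of naturals becomes subtraction of polynomials, legitimate because
    the Fibonacci number is at least 1.\<close>
  also have "of_nat (2 * (fib (2 * n - 1) - 1)) =
      (2 * (of_nat (fib (2 * n - 1)) - 1) :: wheel_vertex int_mpoly)"
  proof -
    have "1 \<le> fib (2 * n - 1)" using n_ge by (simp add: Suc_le_eq fib_neq_0_nat)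
    then show ?thesis by (simp add: of_nat_diff)
  qed
  finally show ?thesis by (simp add: power2_eq_square algebra_simps)
qed

end

theorem theorem44:
  fixes n :: nat
  assumes "n \<ge> 3"
  shows "avalanche_poly (wheel n) =
           of_nat (n\<^sup>2) * wheel_w n n
         + (\<Sum>m=1..n-1. of_nat (m * fib (2 * (n - m))) * wheel_w n m)
         + of_nat (2 * n) * (of_nat (fib (2 * n - 1)) - 1)"
  using wheel_graph.avalanche_poly_wheel[OF wheel_graph.intro[OF assms]] .

end
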